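(* Let $\mathcal{F}$ be a minimal set of constraints pinning $\ell_0$ that contains no degenerate pair and such that $\mathcal{F}^\perp=\{g^\perp\mid g\in\mathcal{F}\}$ does not pin $\ell_0$. Then $\mathcal{F}$ consists of exactly four constraints and $\mathcal{F}^\perp$ is a $4^{\parallel}$-block.
   Context: All lines are oriented. For non-parallel oriented lines $\ell_1,\ell_2$ with directions $d_1,d_2$, $\ell_2$ passes to the right of $\ell_1$ if $\ell_2$ can be translated by a positive multiple of $d_1\times d_2$ to meet $\ell_1$. Coordinates are chosen so that $\ell_0$ is the $z$-axis. A constraint is an oriented line meeting $\ell_0$ in exactly one point; a line satisfies a constraint $g$ if it meets $g$ or passes to the right of $g$. A family of constraints pins $\ell_0$ if there is a neighborhood of $\ell_0$ in the space of oriented lines in which $\ell_0$ is the only line satisfying all its constraints; it is a minimal set pinning $\ell_0$ if no proper subset pins. $g(\lambda,\alpha,\delta)$ denotes the constraint through $(0,0,\lambda)$ and $(\cos\alpha,\sin\alpha,\lambda+\delta)$, oriented from the first to the second point; its orthogonalized constraint is $g^\perp=g(\lambda,\alpha,0)$. A pair of constraints is degenerate if the two lines are at the same time coplanar with $\ell_0$ (lie in a common plane containing $\ell_0$) and concurrent with $\ell_0$ (pass through the same point of $\ell_0$). The normal of $g(\lambda,\alpha,\delta)$ is $\eta_g=\big((1-\lambda)\sin\alpha,-(1-\lambda)\cos\alpha,\lambda\sin\alpha,-\lambda\cos\alpha\big)\in\mathbb{R}^4$. A $k$-simplex (set of $k+1$ affinely independent points) is critical if the origin lies in the relative interior of its convex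 hull and it spans its linear hull. A family of constraints orthogonal to $\ell_0$ is a block if their normals form a critical simplex; a $4^{\parallel}$-block is a block of four such constraints in hyperboloidal position, i.e. belonging to the same family of rulings of a nondegenerate quadric surface. *)

theory Defs
  imports "HOL-Analysis.Analysis" "HOL-Analysis.Cross3"
begin

text \<open>An oriented line is represented by a pair (p, d): a point p and a nonzero
  direction d.  Two representations describe the same oriented line iff they
  have the same Pluecker coordinates (unit direction, moment).\<close>

type_synonym line = "(real^3) \<times> (real^3)"

definition valid_line :: "line \<Rightarrow> bool" where
  "valid_line L \<longleftrightarrow> snd L \<noteq> 0"

definition line_points :: "line \<Rightarrow> (real^3) set" where
  "line_points L = {fst L + t *\<^sub>R snd L | t. True}"

definition unit_dir :: "line \<Rightarrow> real^3" where
  "unit_dir L = (1 / norm (snd L)) *\<^sub>R snd L"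

text \<open>Pluecker embedding of the space of oriented lines into R^3 x R^3;
  the space of oriented lines carries the subspace topology.\<close>
definition pluecker :: "line \<Rightarrow> (real^3) \<times> (real^3)" where
  "pluecker L = (unit_dir L, cross3 (fst L) (unit_dir L))"

definition ell0 :: line where
  "ell0 = (0, vector [0, 0, 1])"

definition meets :: "line \<Rightarrow> line \<Rightarrow> bool" where
  "meets L1 L2 \<longleftrightarrow> line_points L1 \<inter> line_points L2 \<noteq> {}"

definition right_of :: "line \<Rightarrow> line \<Rightarrow> bool" where
  "right_of L2 L1 \<longleftrightarrow> cross3 (snd L1) (snd L2) \<noteq> 0 \<and>
     (\<exists>t>0. meets (fst L2 + t *\<^sub>R cross3 (snd L1) (snd L2), snd L2) L1)"

definition constraint :: "line \<Rightarrow> bool" where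
  "constraint g \<longleftrightarrow> valid_line g \<and> (\<exists>!q. q \<in> line_points g \<and> q \<in> line_points ell0)"

definition satisfies :: "line \<Rightarrow> line \<Rightarrow> bool" where
  "satisfies L g \<longleftrightarrow> meets L g \<or> right_of L g"

definition pins :: "line set \<Rightarrow> bool" where
  "pins F \<longleftrightarrow> (\<exists>U. open U \<and> pluecker ell0 \<in> U \<and>
      (\<forall>L. valid_line L \<and> pluecker L \<in> U \<and> (\<forall>g\<in>F. satisfies L g)
            \<longrightarrow> pluecker L = pluecker ell0))"

definition minimal_pinning :: "line set \<Rightarrow> bool" where
  "minimal_pinning F \<longleftrightarrow> pins F \<and> (\<forall>F'. F' \<subset> F \<longrightarrow> \<not> pins F')"

definition height :: "line \<Rightarrow> real" where
  "height g = (THE q. q \<in> line_points g \<and> q \<in> line_points ell0) $ 3"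

text \<open>Orthogonalized constraint: g(lambda,alpha,delta) maps to g(lambda,alpha,0).\<close>
definition perp :: "line \<Rightarrow> line" where
  "perp g = (vector [0, 0, height g], vector [snd g $ 1, snd g $ 2, 0])"

definition degenerate_pair :: "line \<Rightarrow> line \<Rightarrow> bool" where
  "degenerate_pair g1 g2 \<longleftrightarrow>
     (\<exists>n c. n \<noteq> (0::real^3) \<and>
        line_points ell0 \<union> line_points g1 \<union> line_points g2 \<subseteq> {x. n \<bullet> x = c}) \<and>
     (\<exists>q \<in> line_points ell0. q \<in> line_points g1 \<and> q \<in> line_points g2)"

text \<open>Normal of g(lambda,alpha,delta), where (cos alpha, sin alpha) is the
  normalized horizontal part of the direction.\<close>
definition normal :: "line \<Rightarrow> real^4" where
  "normal g = (let l = height g; r = sqrt ((snd g $ 1)^2 + (snd g $ 2)^2);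
                   c = snd g $ 1 / r; s = snd g $ 2 / r
               in vector [(1 - l) * s, - (1 - l) * c, l * s, - l * c])"

definition critical_simplex :: "(real^4) set \<Rightarrow> bool" where
  "critical_simplex S \<longleftrightarrow> finite S \<and> S \<noteq> {} \<and> \<not> affine_dependent S \<and>
     0 \<in> rel_interior (convex hull S) \<and> affine hull S = span S"

definition orthogonal_constraint :: "line \<Rightarrow> bool" where
  "orthogonal_constraint g \<longleftrightarrow> constraint g \<and> snd g $ 3 = 0"

definition block :: "line set \<Rightarrow> bool" where
  "block F \<longleftrightarrow> finite F \<and> (\<forall>g\<in>F. orthogonal_constraint g) \<and>
     inj_on normal F \<and> critical_simplex (normal ` F)"

definition hom :: "real^3 \<Rightarrow> real^4" where
  "hom x = vector [x $ 1, x $ 2, x $ 3, 1]"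

definition quadric :: "real^4^4 \<Rightarrow> (real^3) set" where
  "quadric M = {x. hom x \<bullet> (M *v hom x) = 0}"

definition nondegenerate_quadric_matrix :: "real^4^4 \<Rightarrow> bool" where
  "nondegenerate_quadric_matrix M \<longleftrightarrow> transpose M = M \<and> det M \<noteq> 0"

definition ruling_family :: "(real^3) set \<Rightarrow> (real^3) set set \<Rightarrow> bool" where
  "ruling_family Q R \<longleftrightarrow>
     (\<forall>r\<in>R. (\<exists>L. valid_line L \<and> r = line_points L) \<and> r \<subseteq> Q) \<and>
     (\<forall>x\<in>Q. \<exists>!r. r \<in> R \<and> x \<in> r)"

definition hyperboloidal :: "line set \<Rightarrow> bool" where
  "hyperboloidal F \<longleftrightarrow> (\<exists>M R. nondegenerate_quadric_matrix M \<and>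
      ruling_family (quadric M) R \<and> (\<forall>g\<in>F. line_points g \<in> R))"

definition four_par_block :: "line set \<Rightarrow> bool" where
  "four_par_block F \<longleftrightarrow> block F \<and> card F = 4 \<and> hyperboloidal F"

end

theory Submission
  imports Defs
begin

text \<open>Near \<open>ell0\<close>, a line is a point \<open>u\<close> of R^4 close to 0: it passes through (u1, u2, 0) and
  (u3, u4, 1). In these coordinates the constraint with normal \<open>\<eta>\<close> and slope \<open>\<delta>\<close> reads
  \<open>\<eta> \<bullet> u \<le> \<delta> * Q u\<close> with \<open>Q u = u1 u4 - u2 u3\<close>, the same quadratic form for all constraints. So the
  family pins iff its convex cone \<open>K\<close> in R^4 x R, given by \<open>\<eta> \<bullet> u \<le> \<delta> * w\<close>, meets the graph
  \<open>w = Q u\<close> only at 0 near 0. If the orthogonalized family does not pin, the slice \<open>w = 0\<close> of \<open>K\<close>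
  contains some \<open>u \<noteq> 0\<close>; pinning then forces \<open>Q\<close> to have a strict sign \<open>\<sigma>\<close> on that slice and
  \<open>\<sigma> * w \<le> 0\<close> on all of \<open>K\<close>. By Farkas and Caratheodory, \<open>(0, \<sigma>)\<close> is a positive combination of
  linearly independent vectors \<open>(\<eta>, -\<delta>)\<close> from a subfamily \<open>B\<close>, whose normals are orthogonal to \<open>u\<close>.
  The orthogonalized constraints of \<open>B\<close> thus meet the line of \<open>u\<close>, which is skew to \<open>ell0\<close>, and are
  rulings of the hyperbolic paraboloid of horizontal lines through both. As there is no degenerate
  pair, their heights are distinct, and since their normals depend quadratically on the height (up to
  scaling), any three of them are independent. Hence \<open>B\<close> has exactly four elements; it already pins,
  so it is the whole family.

  The family may be infinite, and then lines parallel to a constraint without meeting it, which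
  fulfil the inequality but do not satisfy the constraint, accumulate at \<open>ell0\<close>. Minimality makes
  the family countable, so these exceptional lines cannot exhaust a curve; finiteness then
  follows from compactness and Radon's theorem.\<close>

section \<open>Constraints in coordinates\<close>

definition line_of :: "real^4 \<Rightarrow> line" where
  "line_of u = (vector [u$1, u$2, 0], vector [u$3 - u$1, u$4 - u$2, 1])"

text \<open>The determinant of the horizontal positions at heights 0 and 1; it vanishes exactly when
  the line of \<open>u\<close> is coplanar with \<open>ell0\<close>.\<close>

definition pdet :: "real^4 \<Rightarrow> real" where
  "pdet u = u$1 * u$4 - u$2 * u$3"

definition horiz :: "line \<Rightarrow> real" where
  "horiz g = sqrt ((snd g $ 1)^2 + (snd g $ 2)^2)"

text \<open>With the horizontal part of the direction scaled to length 1, this is the parameter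
  \<delta> of g(\<lambda>, \<alpha>, \<delta>).\<close>

definition slope :: "line \<Rightarrow> real" where
  "slope g = snd g $ 3 / horiz g"

lemma vector_4 [simp]:
  "(vector [a,b,c,d] :: 'a::zero^4) $ 1 = a" "(vector [a,b,c,d] :: 'a^4) $ 2 = b"
  "(vector [a,b,c,d] :: 'a^4) $ 3 = c" "(vector [a,b,c,d] :: 'a^4) $ 4 = d"
  unfolding vector_def by auto

lemma inner_4: "x \<bullet> (y::real^4) = x$1*y$1 + x$2*y$2 + x$3*y$3 + x$4*y$4"
  by (simp add: inner_vec_def sum_4)

lemma inner_3: "x \<bullet> (y::real^3) = x$1*y$1 + x$2*y$2 + x$3*y$3"
  by (simp add: inner_vec_def sum_3)

lemma cross3_components:
  "cross3 x y $ 1 = x$2*y$3 - x$3*y$2" "cross3 x y $ 2 = x$3*y$1 - x$1*y$3"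
  "cross3 x y $ 3 = x$1*y$2 - x$2*y$1"
  by (simp_all add: cross3_def)

lemma line_points_ell0: "q \<in> line_points ell0 \<longleftrightarrow> q$1 = 0 \<and> q$2 = 0"
proof
  show "q \<in> line_points ell0 \<Longrightarrow> q$1 = 0 \<and> q$2 = 0"
    by (auto simp: line_points_def ell0_def)
next
  assume "q$1 = 0 \<and> q$2 = 0"
  then have "q = 0 + (q$3) *\<^sub>R vector [0,0,1]"
    by (simp add: vec_eq_iff forall_3)
  then show "q \<in> line_points ell0"
    unfolding line_points_def ell0_def by fastforce
qed

lemma line_points_iff: "x \<in> line_points L \<longleftrightarrow> (\<exists>t. x = fst L + t *\<^sub>R snd L)"
  by (auto simp: line_points_def)

text \<open>A constraint cannot be vertical: a vertical line through a point of the axis shares a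
  second point \<open>y\<close> with it, against uniqueness.\<close>

lemma constraint_point:
  assumes "constraint g"
  shows "vector [0, 0, height g] \<in> line_points g"
    and "horiz g > 0"
proof -
  let ?P = "\<lambda>q. q \<in> line_points g \<and> q \<in> line_points ell0"
  have ex1: "\<exists>!q. ?P q" using assms by (simp add: constraint_def)
  then have q: "?P (THE q. ?P q)" by (rule theI')
  moreover have "(THE q. ?P q) = vector [0, 0, height g]"
    using q by (simp add: vec_eq_iff forall_3 height_def line_points_ell0)
  ultimately show p: "vector [0, 0, height g] \<in> line_points g" by simp
  show "horiz g > 0"
  proof (rule ccontr)
    assume "\<not> horiz g > 0"
    then have h: "snd g $ 1 = 0" "snd g $ 2 = 0"
      using sum_power2_gt_zero_iff[of "snd g $ 1" "snd g $ 2"]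
      by (auto simp: horiz_def)
    define y where "y = vector [0,0,height g] + snd g"
    obtain t where "vector [0,0,height g] = fst g + t *\<^sub>R snd g"
      using p by (auto simp: line_points_iff)
    then have "y = fst g + (t + 1) *\<^sub>R snd g"
      by (simp add: y_def scaleR_left.add)
    then have "y \<in> line_points g" unfolding line_points_iff by blast
    then have "?P y" "?P (vector [0,0,height g])"
      using p h unfolding line_points_ell0 by (simp_all add: y_def)
    then have "y = vector [0,0,height g]" using ex1 by blast
    then have "snd g = 0" by (simp add: y_def)
    then show False using assms by (simp add: constraint_def valid_line_def)
  qed
qed

lemma line_points_shift:
  assumes "a \<in> line_points g"
  shows "x \<in> line_points g \<longleftrightarrow> (\<exists>t. x = a + t *\<^sub>R snd g)"
proof -
  obtain s where a: "a = fst g + s *\<^sub>R snd g" using assms by (auto simp: line_points_iff)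
  show ?thesis
  proof
    assume "x \<in> line_points g"
    then obtain t where "x = fst g + t *\<^sub>R snd g" by (auto simp: line_points_iff)
    then have "x = a + (t - s) *\<^sub>R snd g" by (simp add: a algebra_simps)
    then show "\<exists>t. x = a + t *\<^sub>R snd g" ..
  next
    assume "\<exists>t. x = a + t *\<^sub>R snd g"
    then obtain t where "x = a + t *\<^sub>R snd g" ..
    then have "x = fst g + (s + t) *\<^sub>R snd g" by (simp add: a algebra_simps)
    then show "x \<in> line_points g" unfolding line_points_iff ..
  qed
qed

lemma line_points_scale:
  assumes "a \<in> line_points g" "k \<noteq> 0" "e = k *\<^sub>R snd g"
  shows "line_points (a, e) = line_points g"
proof -
  have "x \<in> line_points (a, e) \<longleftrightarrow> (\<exists>t. x = a + t *\<^sub>R snd g)" for x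
  proof
    assume "x \<in> line_points (a, e)"
    then obtain t where "x = a + (t * k) *\<^sub>R snd g" by (auto simp: line_points_iff assms(3))
    then show "\<exists>t. x = a + t *\<^sub>R snd g" by blast
  next
    assume "\<exists>t. x = a + t *\<^sub>R snd g"
    then obtain t where "x = a + t *\<^sub>R snd g" by blast
    then have "x = a + (t / k) *\<^sub>R e" using assms(2) by (simp add: assms(3))
    then show "x \<in> line_points (a, e)" unfolding line_points_iff fst_conv snd_conv by blast
  qed
  then show ?thesis using line_points_shift[OF assms(1)] by blast
qed

section \<open>Meeting and passing to the right as signs of a triple product\<close>

lemma meets_iff:
  assumes n: "cross3 d e \<noteq> 0"
  shows "meets (p, e) (q, d) \<longleftrightarrow> (p - q) \<bullet> cross3 d e = 0"
proof
  assume "meets (p, e) (q, d)"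
  then obtain s t where "p + s *\<^sub>R e = q + t *\<^sub>R d" by (auto simp: meets_def line_points_def)
  then have "p - q = t *\<^sub>R d - s *\<^sub>R e" by (simp add: algebra_simps)
  then show "(p - q) \<bullet> cross3 d e = 0"
    by (simp add: inner_diff_left dot_cross_self)
next
  let ?n = "cross3 d e" and ?w = "p - q"
  assume z: "?w \<bullet> ?n = 0"
  define s where "s = (cross3 ?w e \<bullet> ?n) / (?n \<bullet> ?n)"
  define t where "t = (cross3 ?w d \<bullet> ?n) / (?n \<bullet> ?n)"
  have nn: "?n \<bullet> ?n \<noteq> 0" using n by simp
  \<comment> \<open>Expansion of \<open>?w\<close> in the basis \<open>d\<close>, \<open>e\<close>,
    \<open>?n\<close> by Cramer's rule; the hypothesis removes the \<open>?n\<close> term.\<close>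
  have "(?n \<bullet> ?n) *\<^sub>R ?w = (cross3 ?w e \<bullet> ?n) *\<^sub>R d - (cross3 ?w d \<bullet> ?n) *\<^sub>R e + (?w \<bullet> ?n) *\<^sub>R ?n"
    unfolding vec_eq_iff forall_3 inner_3 by (simp add: cross3_components algebra_simps)
  then have "(1 / (?n \<bullet> ?n)) *\<^sub>R ((?n \<bullet> ?n) *\<^sub>R ?w)
      = (1 / (?n \<bullet> ?n)) *\<^sub>R ((cross3 ?w e \<bullet> ?n) *\<^sub>R d - (cross3 ?w d \<bullet> ?n) *\<^sub>R e)"
    unfolding z by simp
  then have "?w = (1 / (?n \<bullet> ?n)) *\<^sub>R ((cross3 ?w e \<bullet> ?n) *\<^sub>R d - (cross3 ?w d \<bullet> ?n) *\<^sub>R e)"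
    unfolding scaleR_scaleR using nn by simp
  then have "?w = s *\<^sub>R d - t *\<^sub>R e"
    by (simp add: s_def t_def scaleR_right_diff_distrib)
  then have "p + t *\<^sub>R e = q + s *\<^sub>R d" by (simp add: algebra_simps)
  then show "meets (p, e) (q, d)" by (auto simp: meets_def line_points_def)
qed

text \<open>A translation by \<open>t\<close> times the cross product adds \<open>t\<close> times
  its squared length to the triple product, so a zero occurs for some \<open>t > 0\<close> iff the
  product starts negative. For parallel directions both sides are false.\<close>

lemma right_of_iff:
  "right_of (p, e) (q, d) \<longleftrightarrow> (p - q) \<bullet> cross3 d e < 0"
proof (cases "cross3 d e = 0")
  case True
  then show ?thesis by (simp add: right_of_def)
next
  case False
  let ?n = "cross3 d e" and ?c = "(p - q) \<bullet> cross3 d e"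
  have nn: "?n \<bullet> ?n > 0" using False by simp
  have "meets (p + t *\<^sub>R ?n, e) (q, d) \<longleftrightarrow> ?c + t * (?n \<bullet> ?n) = 0" for t
    using meets_iff[OF False] by (simp add: inner_diff_left inner_add_left algebra_simps)
  then have "right_of (p, e) (q, d) \<longleftrightarrow> (\<exists>t>0. ?c + t * (?n \<bullet> ?n) = 0)"
    using False by (simp add: right_of_def)
  also have "\<dots> \<longleftrightarrow> ?c < 0"
  proof
    assume "\<exists>t>0. ?c + t * (?n \<bullet> ?n) = 0"
    then obtain t where "t > 0" "?c + t * (?n \<bullet> ?n) = 0" by blast
    moreover have "t * (?n \<bullet> ?n) > 0" using \<open>t > 0\<close> nn by simp
    ultimately show "?c < 0" by linarith
  next
    assume "?c < 0"
    then have "- ?c / (?n \<bullet> ?n) > 0 \<and> ?c + (- ?c / (?n \<bullet> ?n)) * (?n \<bullet> ?n) = 0" 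
      using nn by (simp add: field_simps)
    then show "\<exists>t>0. ?c + t * (?n \<bullet> ?n) = 0" by blast
  qed
  finally show ?thesis .
qed

lemma satisfies_iff:
  "cross3 d e \<noteq> 0 \<Longrightarrow> satisfies (p, e) (q, d) \<longleftrightarrow> (p - q) \<bullet> cross3 d e \<le> 0"
  by (auto simp: satisfies_def meets_iff right_of_iff)

text \<open>Only an implication: for parallel directions the product is 0 although the lines may be
  disjoint.\<close>

lemma satisfies_imp:
  "satisfies (p, e) (q, d) \<Longrightarrow> (p - q) \<bullet> cross3 d e \<le> 0"
  by (cases "cross3 d e = 0") (auto simp: satisfies_iff)

lemma satisfies_reparam:
  assumes "k > 0" "p' \<in> line_points (p, e)" "e' = k *\<^sub>R e"
  shows "satisfies (p', e') g \<longleftrightarrow> satisfies (p, e) g"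
proof -
  obtain q d where g: "g = (q, d)" by fastforce
  obtain t where t: "p' = p + t *\<^sub>R e" using assms by (auto simp: line_points_iff)
  have "line_points (p', e') = line_points (p, e)"
    using line_points_scale[of p' "(p, e)" k e'] assms by auto
  then have m: "meets (p', e') g \<longleftrightarrow> meets (p, e) g" by (simp add: meets_def)
  have c: "cross3 d e' = k *\<^sub>R cross3 d e" by (simp add: assms cross_mult_right)
  have "(p' - q) \<bullet> cross3 d e' = k * ((p - q) \<bullet> cross3 d e)"
    by (simp add: t c inner_diff_left inner_add_left dot_cross_self algebra_simps)
  then have "right_of (p', e') g \<longleftrightarrow> right_of (p, e) g"
    unfolding g right_of_iff using assms(1) by (simp add: mult_less_0_iff)
  with m show ?thesis by (simp add: satisfies_def)
qed

lemma normal_components: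
  "normal g $ 1 = (1 - height g) * (snd g $ 2 / horiz g)"
  "normal g $ 2 = - (1 - height g) * (snd g $ 1 / horiz g)"
  "normal g $ 3 = height g * (snd g $ 2 / horiz g)"
  "normal g $ 4 = - height g * (snd g $ 1 / horiz g)"
  by (simp_all add: normal_def Let_def horiz_def)

text \<open>The triple product is independent of the base point chosen on \<open>g\<close>, so the
  point on the axis may be taken. The vertical part of the direction then contributes a multiple of
  \<open>pdet u\<close>, and the horizontal part a linear form.\<close>

lemma line_of_side:
  assumes "constraint g"
  shows "(fst (line_of u) - fst g) \<bullet> cross3 (snd g) (snd (line_of u))
     = horiz g * (normal g \<bullet> u - slope g * pdet u)"
proof -
  obtain t where t: "vector [0, 0, height g] = fst g + t *\<^sub>R snd g"
    using constraint_point(1)[OF assms] by (auto simp: line_points_iff)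
  then have f: "fst g = vector [0,0,height g] - t *\<^sub>R snd g" by (simp add: algebra_simps)
  have h: "horiz g \<noteq> 0" using constraint_point(2)[OF assms] by simp
  define d1 d2 d3 l where d: "d1 = snd g $ 1" "d2 = snd g $ 2" "d3 = snd g $ 3" "l = height g"
  define r where "r = horiz g"
  have "r * (normal g \<bullet> u - slope g * pdet u) = 
     (1-l)*d2*u$1 - (1-l)*d1*u$2 + l*d2*u$3 - l*d1*u$4 - d3 * pdet u"
    using h unfolding r_def[symmetric]
    by (simp add: inner_4 normal_components slope_def r_def[symmetric] d[symmetric] field_simps)
  then show ?thesis unfolding f r_def[symmetric]
    by (simp add: inner_3 cross3_components line_of_def d[symmetric] pdet_def algebra_simps)
qed

lemma satisfies_line_of:
  assumes "constraint g" "satisfies (line_of u) g"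
  shows "normal g \<bullet> u \<le> slope g * pdet u"
proof -
  have "(fst (line_of u) - fst g) \<bullet> cross3 (snd g) (snd (line_of u)) \<le> 0"
    using assms(2) satisfies_imp[of "fst (line_of u)" "snd (line_of u)" "fst g" "snd g"] by simp
  then show ?thesis
    using constraint_point(2)[OF assms(1)] 
    by (simp add: line_of_side[OF assms(1)] mult_le_0_iff)
qed

lemma line_of_satisfies:
  assumes "constraint g" "normal g \<bullet> u \<le> slope g * pdet u"
    and "cross3 (snd g) (snd (line_of u)) \<noteq> 0"
  shows "satisfies (line_of u) g"
proof -
  have "(fst (line_of u) - fst g) \<bullet> cross3 (snd g) (snd (line_of u)) \<le> 0"
    using constraint_point(2)[OF assms(1)] assms(2)
    by (simp add: line_of_side[OF assms(1)] mult_le_0_iff)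
  then show ?thesis
    using satisfies_iff[of "snd g" "snd (line_of u)" "fst (line_of u)" "fst g"] assms(3) by simp
qed

text \<open>The exceptional lines of one constraint: two coordinate differences are fixed, not both
  at 0, so these lines lie in a plane of R^4 that avoids the origin.\<close>

lemma parallel_line_of:
  assumes "constraint g" "cross3 (snd g) (snd (line_of u)) = 0"
  shows "snd g $ 3 \<noteq> 0" "u$3 - u$1 = snd g $ 1 / snd g $ 3" "u$4 - u$2 = snd g $ 2 / snd g $ 3"
    "\<not> (snd g $ 1 = 0 \<and> snd g $ 2 = 0)"
proof -
  show nz: "\<not> (snd g $ 1 = 0 \<and> snd g $ 2 = 0)"
    using constraint_point(2)[OF assms(1)] by (auto simp: horiz_def)
  have e: "snd g $ 2 = snd g $ 3 * (u$4 - u$2)" "snd g $ 1 = snd g $ 3 * (u$3 - u$1)"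
    using assms(2) by (simp_all add: vec_eq_iff forall_3 cross3_components line_of_def)
  then show z: "snd g $ 3 \<noteq> 0" using nz by auto
  show "u$3 - u$1 = snd g $ 1 / snd g $ 3" "u$4 - u$2 = snd g $ 2 / snd g $ 3"
    using e z by (simp_all add: field_simps)
qed

section \<open>A chart of the upward directed lines\<close>

text \<open>For direction \<open>d\<close> and moment \<open>m\<close>, these are the intersections
  of the line with the planes at heights 0 and 1.\<close>

definition chart :: "(real^3) \<times> (real^3) \<Rightarrow> real^4" where
  "chart x = (let d = fst x; m = snd x in
     vector [- (m$2) / d$3, m$1 / d$3, (d$1 - m$2) / d$3, (d$2 + m$1) / d$3])"

lemma vector_3_axis:
  "(vector [a,b,c] :: real^3) = a *\<^sub>R axis 1 1 + b *\<^sub>R axis 2 1 + c *\<^sub>R axis 3 1"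
  by (simp add: vec_eq_iff forall_3 axis_def)

lemma vector_4_axis:
  "(vector [a,b,c,d] :: real^4) = a *\<^sub>R axis 1 1 + b *\<^sub>R axis 2 1 + c *\<^sub>R axis 3 1 + d *\<^sub>R axis 4 1"
  by (simp add: vec_eq_iff forall_4 axis_def)

lemma exists_3: "(\<exists>i::3. P i) \<longleftrightarrow> P 1 \<or> P 2 \<or> P 3"
  by (metis exhaust_3)

lemma pluecker_reparam:
  assumes "k > 0" "p' \<in> line_points (p, e)" "e' = k *\<^sub>R e"
  shows "pluecker (p', e') = pluecker (p, e)"
proof -
  obtain t where t: "p' = p + t *\<^sub>R e" using assms by (auto simp: line_points_iff)
  have "unit_dir (p', e') = unit_dir (p, e)"
    using assms(1) by (simp add: unit_dir_def assms(3))
  then show ?thesis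
    by (simp add: pluecker_def t unit_dir_def cross_add_left cross_mult_left cross_mult_right cross_refl)
qed

lemma chart_pluecker:
  assumes "snd L $ 3 > 0"
  shows "chart (pluecker L) = vector
    [fst L $ 1 - fst L $ 3 * snd L $ 1 / snd L $ 3,
     fst L $ 2 - fst L $ 3 * snd L $ 2 / snd L $ 3,
     fst L $ 1 - fst L $ 3 * snd L $ 1 / snd L $ 3 + snd L $ 1 / snd L $ 3,
     fst L $ 2 - fst L $ 3 * snd L $ 2 / snd L $ 3 + snd L $ 2 / snd L $ 3]"
proof -
  have "norm (snd L) \<noteq> 0" using assms by auto
  then show ?thesis using assms
    by (simp add: vec_eq_iff forall_4 chart_def pluecker_def unit_dir_def Let_def
        cross3_components divide_simps)
qed

lemma line_of_chart:
  assumes "snd L $ 3 > 0"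
  shows "pluecker (line_of (chart (pluecker L))) = pluecker L"
    and "satisfies (line_of (chart (pluecker L))) g \<longleftrightarrow> satisfies L g"
proof -
  let ?u = "chart (pluecker L)" and ?z = "snd L $ 3"
  have s: "snd (line_of ?u) = (1 / ?z) *\<^sub>R snd L"
    using assms by (simp add: vec_eq_iff forall_3 line_of_def chart_pluecker)
  have "fst (line_of ?u) = fst L + (- (fst L $ 3) / ?z) *\<^sub>R snd L"
    using assms by (simp add: vec_eq_iff forall_3 line_of_def chart_pluecker)
  then have f: "fst (line_of ?u) \<in> line_points (fst L, snd L)"
    unfolding line_points_iff fst_conv snd_conv ..
  have k: "1 / ?z > 0" using assms by simp
  show "pluecker (line_of ?u) = pluecker L"
    using pluecker_reparam[OF k f s] by simp
  show "satisfies (line_of ?u) g \<longleftrightarrow> satisfies L g"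
    using satisfies_reparam[OF k f s] by simp
qed

lemma chart_line_of: "chart (pluecker (line_of u)) = u"
proof -
  have "snd (line_of u) $ 3 > 0" by (simp add: line_of_def)
  then show ?thesis
    unfolding chart_pluecker[OF \<open>snd (line_of u) $ 3 > 0\<close>]
    by (simp add: vec_eq_iff forall_4 line_of_def)
qed

lemma line_of_0: "line_of 0 = ell0"
  by (simp add: line_of_def ell0_def vec_eq_iff forall_3)

lemma continuous_pluecker_line_of: "continuous_on UNIV (\<lambda>u. pluecker (line_of u))"
proof -
  have d: "snd (line_of u) \<noteq> 0" for u
    by (simp add: line_of_def vec_eq_iff exists_3)
  have "continuous_on UNIV line_of"
    unfolding line_of_def[abs_def] vector_3_axis by (intro continuous_intros)
  then show ?thesis
    unfolding pluecker_def unit_dir_def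
    by (intro continuous_intros continuous_on_cross) (auto simp: d)
qed

lemma open_chart_preimage:
  "open {x. fst x $ 3 > 0 \<and> norm (chart x) < \<epsilon>}"
proof -
  have "continuous_on {x :: (real^3) \<times> (real^3). fst x $ 3 > 0} chart"
    unfolding chart_def Let_def vector_4_axis
    by (intro continuous_intros) auto
  moreover have "open {x :: (real^3) \<times> (real^3). fst x $ 3 > 0}"
    by (intro open_Collect_less continuous_intros)
  ultimately have "open ({x. fst x $ 3 > 0} \<inter> chart -` ball 0 \<epsilon>)"
    by (intro continuous_open_preimage) auto
  also have "{x. fst x $ 3 > 0} \<inter> chart -` ball 0 \<epsilon> = {x. fst x $ 3 > 0 \<and> norm (chart x) < \<epsilon>}"
    by auto
  finally show ?thesis .
qed

text \<open>\<open>line_of\<close> and \<open>chart\<close> are continuous and inverse to each other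
  on upward directed lines, so neighborhoods of \<open>ell0\<close> can be traded for balls around 0
  in R^4.\<close>

lemma pins_iff:
  "pins F \<longleftrightarrow> (\<exists>\<epsilon>>0. \<forall>u. norm u < \<epsilon> \<and> (\<forall>g\<in>F. satisfies (line_of u) g) \<longrightarrow> u = 0)"
proof
  assume "pins F"
  then obtain U where U: "open U" "pluecker ell0 \<in> U"
    and pin: "\<And>L. valid_line L \<Longrightarrow> pluecker L \<in> U \<Longrightarrow> \<forall>g\<in>F. satisfies L g \<Longrightarrow> pluecker L = pluecker ell0"
    unfolding pins_def by blast
  have "open ((\<lambda>u. pluecker (line_of u)) -` U)"
    using continuous_on_open_vimage[of UNIV "\<lambda>u. pluecker (line_of u)"] continuous_pluecker_line_of U(1)
    by auto
  moreover have "0 \<in> (\<lambda>u. pluecker (line_of u)) -` U" using U(2) by (simp add: line_of_0)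
  ultimately obtain \<epsilon> where e: "\<epsilon> > 0" "ball 0 \<epsilon> \<subseteq> (\<lambda>u. pluecker (line_of u)) -` U"
    using open_contains_ball by blast
  have "u = 0" if "norm u < \<epsilon>" "\<forall>g\<in>F. satisfies (line_of u) g" for u
  proof -
    have "pluecker (line_of u) \<in> U" using e(2) that(1) by auto
    moreover have "valid_line (line_of u)" by (simp add: valid_line_def line_of_def vec_eq_iff exists_3)
    ultimately have "pluecker (line_of u) = pluecker (line_of 0)" using pin that(2) by (simp add: line_of_0)
    then show "u = 0" using chart_line_of by metis
  qed
  then show "\<exists>\<epsilon>>0. \<forall>u. norm u < \<epsilon> \<and> (\<forall>g\<in>F. satisfies (line_of u) g) \<longrightarrow> u = 0"
    using e(1) by blast
next
  assume "\<exists>\<epsilon>>0. \<forall>u. norm u < \<epsilon> \<and> (\<forall>g\<in>F. satisfies (line_of u) g) \<longrightarrow> u = 0"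
  then obtain \<epsilon> where e: "\<epsilon> > 0"
    "\<And>u. norm u < \<epsilon> \<Longrightarrow> \<forall>g\<in>F. satisfies (line_of u) g \<Longrightarrow> u = 0" by blast
  let ?U = "{x. fst x $ 3 > 0 \<and> norm (chart x) < \<epsilon>}"
  show "pins F" unfolding pins_def
  proof (intro exI[of _ ?U] conjI allI impI)
    show "open ?U" by (rule open_chart_preimage)
    have "chart (pluecker ell0) = 0" using chart_line_of[of 0] by (simp add: line_of_0)
    then show "pluecker ell0 \<in> ?U"
      using e(1) by simp (simp add: pluecker_def unit_dir_def ell0_def vec_eq_iff exists_3)
  next
    fix L assume L: "valid_line L \<and> pluecker L \<in> ?U \<and> (\<forall>g\<in>F. satisfies L g)"
    then have "snd L $ 3 > 0"
      by (auto simp: pluecker_def unit_dir_def valid_line_def zero_less_divide_iff)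
    note l = line_of_chart[OF this]
    have "chart (pluecker L) = 0"
      using L by (intro e(2)) (auto simp: l)
    then show "pluecker L = pluecker ell0" using l(1) by (simp add: line_of_0)
  qed
qed

section \<open>The convex cone of admissible pairs\<close>

definition admissible :: "line set \<Rightarrow> real^4 \<Rightarrow> real \<Rightarrow> bool" where
  "admissible F u w \<longleftrightarrow> (\<forall>g\<in>F. normal g \<bullet> u \<le> slope g * w)"

lemma admissible_add:
  "admissible F u w \<Longrightarrow> admissible F u' w' \<Longrightarrow> admissible F (u + u') (w + w')"
  unfolding admissible_def by (force simp: inner_add_right distrib_left)

lemma admissible_scale:
  "admissible F u w \<Longrightarrow> t \<ge> 0 \<Longrightarrow> admissible F (t *\<^sub>R u) (t * w)"
  unfolding admissible_def
  by (metis inner_scaleR_right mult.left_commute mult_left_mono)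

lemma admissible_mono: "admissible F u w \<Longrightarrow> G \<subseteq> F \<Longrightarrow> admissible G u w"
  unfolding admissible_def by blast

lemma pdet_scale: "pdet (t *\<^sub>R u) = t\<^sup>2 * pdet u"
  by (simp add: pdet_def power2_eq_square algebra_simps)

lemma continuous_pdet: "continuous_on A pdet"
  unfolding pdet_def by (intro continuous_intros)

section \<open>Orthogonalized constraints\<close>

lemma line_points_perp:
  "q \<in> line_points (perp g) \<longleftrightarrow> q$3 = height g \<and> (\<exists>t. q$1 = t * snd g $ 1 \<and> q$2 = t * snd g $ 2)"
  unfolding line_points_iff perp_def fst_conv snd_conv by (auto simp: vec_eq_iff forall_3)

lemma perp_ell0_iff:
  "q \<in> line_points (perp g) \<and> q \<in> line_points ell0 \<longleftrightarrow> q = vector [0, 0, height g]"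
proof
  assume "q \<in> line_points (perp g) \<and> q \<in> line_points ell0"
  then show "q = vector [0, 0, height g]"
    by (simp add: line_points_perp line_points_ell0 vec_eq_iff forall_3)
next
  assume "q = vector [0, 0, height g]"
  then have "q$3 = height g" "q$1 = 0 * snd g $ 1" "q$2 = 0 * snd g $ 2" by simp_all
  then show "q \<in> line_points (perp g) \<and> q \<in> line_points ell0"
    unfolding line_points_perp line_points_ell0 by (metis mult_zero_left)
qed

lemma height_perp [simp]: "height (perp g) = height g"
  unfolding height_def[of "perp g"] perp_ell0_iff by simp

lemma snd_perp [simp]: "snd (perp g) $ 1 = snd g $ 1" "snd (perp g) $ 2 = snd g $ 2" "snd (perp g) $ 3 = 0"
  by (simp_all add: perp_def)

lemma normal_perp [simp]: "normal (perp g) = normal g"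
  by (simp add: normal_def)

lemma slope_perp [simp]: "slope (perp g) = 0"
  by (simp add: slope_def)

lemma orthogonal_constraint_perp:
  assumes "constraint g"
  shows "orthogonal_constraint (perp g)"
proof -
  have nz: "snd g $ 1 \<noteq> 0 \<or> snd g $ 2 \<noteq> 0"
    using constraint_point(2)[OF assms] by (auto simp: horiz_def)
have "valid_line (perp g)"
    using nz by (auto simp: valid_line_def perp_def vec_eq_iff exists_3)
  then show ?thesis by (simp add: orthogonal_constraint_def constraint_def perp_ell0_iff)
qed

section \<open>Pinning and the cone of admissible pairs\<close>

text \<open>Otherwise satisfying lines \<open>u n\<close> tend to 0. Normalized to
  \<open>v n\<close>, they have a limit direction \<open>l\<close>; as \<open>pdet\<close> is
  quadratic, the right sides keep a factor \<open>norm (u n)\<close> and vanish in the limit. So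
  \<open>l\<close> lies in the slice \<open>w = 0\<close>, while the second hypothesis gives
  \<open>\<sigma> * pdet l \<le> 0\<close>.\<close>

lemma pins_if_admissible:
  assumes F: "\<forall>g\<in>F. constraint g"
    and K0: "\<And>u. admissible F u 0 \<Longrightarrow> u \<noteq> 0 \<Longrightarrow> \<sigma> * pdet u > 0"
    and K: "\<And>u w. admissible F u w \<Longrightarrow> \<sigma> * w \<le> 0"
  shows "pins F"
proof (rule ccontr)
  assume "\<not> pins F"
  then have "\<exists>u. norm u < 1 / Suc n \<and> (\<forall>g\<in>F. satisfies (line_of u) g) \<and> u \<noteq> 0" for n
    unfolding pins_iff by (metis of_nat_0_less_iff zero_less_Suc zero_less_divide_1_iff)
  then obtain u where u: "\<And>n. norm (u n) < 1 / Suc n" "\<And>n. u n \<noteq> 0"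
    and sat: "\<And>n g. g \<in> F \<Longrightarrow> satisfies (line_of (u n)) g" by metis
  define v where "v n = (1 / norm (u n)) *\<^sub>R u n" for n
  have uv: "u n = norm (u n) *\<^sub>R v n" for n using u(2)[of n] by (simp add: v_def)
  have adm: "admissible F (u n) (pdet (u n))" for n
    using sat satisfies_line_of F by (auto simp: admissible_def)
  have sgn: "\<sigma> * pdet (v n) \<le> 0" for n
  proof -
    have "\<sigma> * pdet (v n) = (1 / norm (u n))\<^sup>2 * (\<sigma> * pdet (u n))"
      by (simp add: v_def pdet_scale)
    also have "\<dots> \<le> 0" using K[OF adm[of n]] by (rule mult_nonneg_nonpos[OF zero_le_power2])
    finally show ?thesis .
  qed
  have ineq: "normal g \<bullet> v n \<le> slope g * (norm (u n) * pdet (v n))" if "g \<in> F" for g n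
  proof -
    have eq: "(1 / norm (u n)) * pdet (u n) = norm (u n) * pdet (v n)"
      using u(2)[of n] by (simp add: v_def pdet_scale power2_eq_square)
    have "admissible F (v n) ((1 / norm (u n)) * pdet (u n))"
      unfolding v_def using adm by (rule admissible_scale) simp
    then show ?thesis using that unfolding eq admissible_def by blast
  qed
  have "v n \<in> sphere 0 1" for n using u(2)[of n] by (simp add: v_def)
  then obtain l r where l: "l \<in> sphere 0 1" "strict_mono r" "(v \<circ> r) \<longlonglongrightarrow> l"
    using compact_sphere[of "0::real^4" 1] unfolding compact_def by metis
  have u0: "(\<lambda>n. norm (u (r n))) \<longlonglongrightarrow> 0"
  proof (rule tendsto_sandwich[of "\<lambda>_. 0" _ _ "\<lambda>n. 1 / Suc n"])
    have "1 / real (Suc (r n)) \<le> 1 / real (Suc n)" for n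
      using seq_suble[OF l(2), of n] by (simp add: frac_le)
    then show "\<forall>\<^sub>F n in sequentially. norm (u (r n)) \<le> 1 / Suc n"
      using u(1) by (intro always_eventually allI) (meson less_le_trans less_imp_le)
    show "(\<lambda>n. 1 / real (Suc n)) \<longlonglongrightarrow> 0" using LIMSEQ_inverse_real_of_nat by (simp add: inverse_eq_divide)
  qed auto
  have pv: "(\<lambda>n. pdet (v (r n))) \<longlonglongrightarrow> pdet l"
    using continuous_on_tendsto_compose[OF continuous_pdet[of UNIV] l(3)] by (simp add: o_def)
  have "\<sigma> * pdet l \<le> 0"
    by (rule tendsto_upperbound[OF tendsto_mult_left[OF pv]]) (auto simp: sgn)
  moreover have "normal g \<bullet> l \<le> 0" if "g \<in> F" for g
  proof -
    have 1: "(\<lambda>n. normal g \<bullet> v (r n)) \<longlonglongrightarrow> normal g \<bullet> l"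
      using l(3) by (intro tendsto_intros) (simp add: o_def)
    have 2: "(\<lambda>n. slope g * (norm (u (r n)) * pdet (v (r n)))) \<longlonglongrightarrow> slope g * (0 * pdet l)"
      by (intro tendsto_intros u0 pv)
    show ?thesis using LIMSEQ_le[OF 1 2] ineq[OF that] by auto
  qed
  moreover have "l \<noteq> 0" using l(1) by auto
  ultimately show False using K0[of l] by (auto simp: admissible_def)
qed

lemma not_pins_perpD:
  assumes "\<forall>g\<in>F. constraint g" "\<not> pins (perp ` F)"
  obtains u where "u \<noteq> 0" "admissible F u 0"
proof -
  obtain u where u: "\<forall>g\<in>perp ` F. satisfies (line_of u) g" "u \<noteq> 0"
    using assms(2) unfolding pins_iff by (meson zero_less_one)
  have "normal g \<bullet> u \<le> 0" if "g \<in> F" for g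
    using satisfies_line_of[of "perp g" u] orthogonal_constraint_perp[of g] that u(1) assms(1)
    by (auto simp: orthogonal_constraint_def)
  then show ?thesis using that u(2) by (auto simp: admissible_def)
qed

text \<open>A line violating only \<open>g\<close> gives an open half-space containing the vector \<open>(\<eta>, -\<delta>)\<close> of \<open>g\<close> and
  of no other constraint, so these vectors form a discrete set.\<close>

lemma countable_if_minimal:
  assumes F: "\<forall>g\<in>F. constraint g" and min: "minimal_pinning F"
  shows "countable F"
proof -
  define p where "p g = (normal g, - slope g)" for g
  have ex: "\<exists>U. open U \<and> p g \<in> U \<and> (\<forall>h\<in>F. p h \<in> U \<longrightarrow> h = g)" if g: "g \<in> F" for g
  proof -
    obtain \<epsilon> where e: "\<epsilon> > 0"
      "\<And>u. norm u < \<epsilon> \<Longrightarrow> \<forall>g\<in>F. satisfies (line_of u) g \<Longrightarrow> u = 0"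
      using min unfolding minimal_pinning_def pins_iff by blast
    define nz where "nz u \<longleftrightarrow> cross3 (snd g) (snd (line_of u)) \<noteq> 0" for u
    \<comment> \<open>Close to \<open>ell0\<close> no line is parallel to \<open>g\<close>, so
      violating \<open>g\<close> there means the strict opposite inequality.\<close>
    obtain \<delta> where d: "\<delta> > 0" "\<And>u. norm u < \<delta> \<Longrightarrow> nz u"
    proof -
      have "open {u. nz u}"
      proof -
        have "continuous_on UNIV (\<lambda>u. cross3 (snd g) (snd (line_of u)))"
          unfolding line_of_def snd_conv vector_3_axis
          by (intro continuous_intros continuous_on_cross)
        then have "open ((\<lambda>u. cross3 (snd g) (snd (line_of u))) -` (- {0}))"
          using continuous_on_open_vimage[of UNIV] by (metis Int_UNIV_right open_Compl closed_singleton open_UNIV)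
        then show ?thesis by (simp add: nz_def vimage_def)
      qed
      moreover have "nz 0"
        using parallel_line_of(2,3)[of g 0] parallel_line_of(1,4)[of g 0] F g unfolding nz_def by auto
      ultimately obtain \<delta> where "\<delta> > 0" "ball 0 \<delta> \<subseteq> {u. nz u}"
        using open_contains_ball by blast
      then show ?thesis using that by (metis mem_ball_0 mem_Collect_eq subsetD)
    qed
    have "\<not> pins (F - {g})" using min g by (auto simp: minimal_pinning_def)
    then obtain u where u: "norm u < min \<epsilon> \<delta>" "\<forall>h\<in>F - {g}. satisfies (line_of u) h" "u \<noteq> 0"
      unfolding pins_iff using e(1) d(1) by (meson min_less_iff_conj)
    have "\<not> satisfies (line_of u) g"
      using e(2)[of u] u by auto
    then have pos: "normal g \<bullet> u > slope g * pdet u"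
      using line_of_satisfies[of g u] d(2)[of u] u(1) F g unfolding nz_def by fastforce
    have neg: "normal h \<bullet> u \<le> slope h * pdet u" if "h \<in> F" "h \<noteq> g" for h
      using satisfies_line_of u(2) F that by simp
    show ?thesis
    proof (intro exI conjI ballI impI)
      show "open {x. (u, pdet u) \<bullet> x > 0}" by (rule open_halfspace_gt)
      show "p g \<in> {x. (u, pdet u) \<bullet> x > 0}"
        using pos by (simp add: p_def inner_commute mult.commute)
      fix h assume "h \<in> F" "p h \<in> {x. (u, pdet u) \<bullet> x > 0}"
      then show "h = g" using neg[of h] by (force simp: p_def inner_commute mult.commute)
    qed
  qed
  \<comment> \<open>A basic open set that isolates \<open>g\<close> determines \<open>g\<close>,
    which gives an injection of \<open>F\<close> into a countable basis.\<close>
  obtain \<B> :: "((real^4) \<times> real) set set" where B: "countable \<B>" "topological_basis \<B>"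
    using ex_countable_basis by blast
  have "\<exists>b\<in>\<B>. p g \<in> b \<and> (\<forall>h\<in>F. p h \<in> b \<longrightarrow> h = g)" if "g \<in> F" for g
    using ex[OF that] topological_basisE[OF B(2)] by (metis subsetD)
  then obtain b where b: "\<And>g. g \<in> F \<Longrightarrow> b g \<in> \<B>" "\<And>g. g \<in> F \<Longrightarrow> p g \<in> b g"
    "\<And>g h. g \<in> F \<Longrightarrow> h \<in> F \<Longrightarrow> p h \<in> b g \<Longrightarrow> h = g" by metis
  have "inj_on b F" by (rule inj_onI) (metis b(2,3))
  moreover have "countable (b ` F)" using b(1) B(1) by (meson countable_subset image_subsetI)
  ultimately show ?thesis using countable_image_inj_on by blast
qed

section \<open>Curves of solutions and the sign of \<open>pdet\<close>\<close>

text \<open>Each of the countably many constraints is parallel to the line of \<open>c s\<close> for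
  only countably many \<open>s\<close>. Some arbitrarily small \<open>s\<close> escapes them all,
  and there the inequalities amount to satisfying every constraint.\<close>

lemma curve_not_pins:
  fixes c :: "real \<Rightarrow> real^4"
  assumes F: "\<forall>g\<in>F. constraint g" "countable F" and pin: "pins F"
    and a: "a > 0" and lim: "(c \<longlongrightarrow> 0) (at_right 0)"
    and c: "\<And>s. s \<in> {0<..<a} \<Longrightarrow> c s \<noteq> 0 \<and> admissible F (c s) (pdet (c s))"
    and par: "\<And>x y. (x, y) \<noteq> (0, 0) \<Longrightarrow>
      countable {s \<in> {0<..<a}. c s $ 3 - c s $ 1 = x \<and> c s $ 4 - c s $ 2 = y}"
  shows False
proof -
  obtain \<epsilon> where e: "\<epsilon> > 0"
    "\<And>u. norm u < \<epsilon> \<Longrightarrow> \<forall>g\<in>F. satisfies (line_of u) g \<Longrightarrow> u = 0"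
    using pin unfolding pins_iff by blast
  have "\<forall>\<^sub>F s in at_right 0. norm (c s) < \<epsilon>"
    using tendstoD[OF lim e(1)] by simp
  then obtain b where b: "b > 0" "\<And>s. 0 < s \<Longrightarrow> s < b \<Longrightarrow> norm (c s) < \<epsilon>"
    unfolding eventually_at_right_field by blast
  define x where "x g = snd g $ 1 / snd g $ 3" for g :: line
  define y where "y g = snd g $ 2 / snd g $ 3" for g :: line
  \<comment> \<open>For a horizontal constraint both quotients are 0 by the convention on division;
    it is left out, being parallel to no \<open>line_of u\<close>.\<close>
  define Bad where "Bad = (\<Union>g\<in>{g\<in>F. (x g, y g) \<noteq> (0, 0)}.
    {s \<in> {0<..<a}. c s $ 3 - c s $ 1 = x g \<and> c s $ 4 - c s $ 2 = y g})"
  have "countable Bad" unfolding Bad_def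
  proof (rule countable_UN)
    show "countable {g \<in> F. (x g, y g) \<noteq> (0, 0)}" using F(2) by simp
  qed (use par in blast)
  moreover have "uncountable {0<..<min a b}"
    using a b(1) by (simp add: uncountable_open_interval)
  ultimately obtain s where s: "s \<in> {0<..<min a b}" "s \<notin> Bad"
    by (meson countable_subset subsetI)
  have "satisfies (line_of (c s)) g" if g: "g \<in> F" for g
  proof (rule line_of_satisfies)
    show g': "constraint g" using F(1) g by blast
    show "normal g \<bullet> c s \<le> slope g * pdet (c s)"
      using c[of s] s(1) g by (auto simp: admissible_def)
    show "cross3 (snd g) (snd (line_of (c s))) \<noteq> 0"
    proof
      assume "cross3 (snd g) (snd (line_of (c s))) = 0"
      note p = parallel_line_of[OF g' this]
      then have "(x g, y g) \<noteq> (0, 0)" by (auto simp: x_def y_def)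
      moreover have "c s $ 3 - c s $ 1 = x g \<and> c s $ 4 - c s $ 2 = y g"
        using p(2,3) by (simp add: x_def y_def)
      ultimately show False using s g unfolding Bad_def by fastforce
    qed
  qed
  then have "c s = 0" using e(2)[of "c s"] b(2)[of s] s(1) by auto
  then show False using c[of s] s(1) by auto
qed

lemma finite_quadratic_roots:
  fixes a :: real
  assumes "a \<noteq> 0"
  shows "finite {s. a + s * b + s\<^sup>2 * c = 0}"
proof -
  have "finite {s. poly [:a, b, c:] s = 0}"
    using assms by (intro poly_roots_finite) auto
  then show ?thesis by (simp add: power2_eq_square algebra_simps)
qed

text \<open>Otherwise the ray through \<open>u\<close> would be a curve of solutions, lying both in
  the slice \<open>w = 0\<close> and on the graph of \<open>pdet\<close>.\<close>

lemma pins_pdet_nonzero: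
  assumes F: "\<forall>g\<in>F. constraint g" "countable F" "pins F"
    and u: "admissible F u 0" "u \<noteq> 0"
  shows "pdet u \<noteq> 0"
proof
  assume z: "pdet u = 0"
  show False
  proof (rule curve_not_pins[OF F, of 1 "\<lambda>s. s *\<^sub>R u"])
    show "((\<lambda>s. s *\<^sub>R u) \<longlongrightarrow> 0) (at_right 0)"
      by (rule tendsto_eq_intros refl | simp)+
    fix s :: real assume "s \<in> {0<..<1}"
    then show "s *\<^sub>R u \<noteq> 0 \<and> admissible F (s *\<^sub>R u) (pdet (s *\<^sub>R u))"
      using admissible_scale[OF u(1), of s] u(2) z by (simp add: pdet_scale)
  next
    fix x y :: real assume "(x, y) \<noteq> (0, 0)"
    then have "{s \<in> {0<..<1}. (s *\<^sub>R u) $ 3 - (s *\<^sub>R u) $ 1 = x \<and> (s *\<^sub>R u) $ 4 - (s *\<^sub>R u) $ 2 = y}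
      \<subseteq> {x / (u$3 - u$1), y / (u$4 - u$2)}"
      by (auto simp: right_diff_distrib[symmetric])
    then show "countable {s \<in> {0<..<1}. (s *\<^sub>R u) $ 3 - (s *\<^sub>R u) $ 1 = x \<and> (s *\<^sub>R u) $ 4 - (s *\<^sub>R u) $ 2 = y}"
      by (rule countable_subset) simp
  qed simp
qed

text \<open>If \<open>w\<close> and \<open>pdet u\<close> had the same sign, the ray through \<open>(u + s v, s w)\<close> would meet the graph of
  \<open>pdet\<close>, at a point tending to 0 with \<open>s\<close>.\<close>

lemma pins_same_sign:
  assumes F: "\<forall>g\<in>F. constraint g" "countable F" "pins F"
    and u: "admissible F u 0" and w: "admissible F v w"
  shows "w * pdet u \<le> 0"
proof (rule ccontr)
  assume "\<not> w * pdet u \<le> 0"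
  then have pos: "w * pdet u > 0" by simp
  define q where "q s = pdet (u + s *\<^sub>R v)" for s
  \<comment> \<open>The polarization of \<open>pdet\<close>, that is, the coefficient of
    \<open>s\<close> in \<open>q s\<close>.\<close>
  define B where "B = u$1 * v$4 + v$1 * u$4 - u$2 * v$3 - v$2 * u$3"
  have q: "q s = pdet u + s * B + s\<^sup>2 * pdet v" for s
    by (simp add: q_def pdet_def B_def power2_eq_square algebra_simps)
  have "((\<lambda>s. w * q s) \<longlongrightarrow> w * q 0) (at_right 0)"
    unfolding q by (intro tendsto_intros)
  then have "\<forall>\<^sub>F s in at_right 0. w * q s > 0"
    using pos by (intro order_tendstoD(1)) (auto simp: q)
  then obtain a where a: "a > 0" "\<And>s. 0 < s \<Longrightarrow> s < a \<Longrightarrow> w * q s > 0"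
    unfolding eventually_at_right_field by blast
  \<comment> \<open>The factor is the nonzero root \<open>t\<close> of
    \<open>t\<^sup>2 * q s = t * (s * w)\<close>, where the ray through the pair of
    \<open>u + s *\<^sub>R v\<close> and \<open>s * w\<close> meets the graph of
    \<open>pdet\<close>.\<close>
  define c where "c s = (s * w / q s) *\<^sub>R (u + s *\<^sub>R v)" for s
  show False
  proof (rule curve_not_pins[OF F a(1), of c])
    have "((\<lambda>s. (s * w / q s) *\<^sub>R (u + s *\<^sub>R v)) \<longlongrightarrow> (0 * w / q 0) *\<^sub>R (u + 0 *\<^sub>R v)) (at_right 0)"
      unfolding q using pos by (intro tendsto_intros) auto
    then show "(c \<longlongrightarrow> 0) (at_right 0)" by (simp add: c_def[abs_def])
  next
    fix s assume s: "s \<in> {0<..<a}"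
    then have wq: "w * q s > 0" using a(2) by simp
    then have nz: "w \<noteq> 0" "q s \<noteq> 0" by auto
    then have "s * w / q s = s * (w * q s) / (q s)\<^sup>2" by (simp add: power2_eq_square)
    with nz wq s have t: "s * w / q s \<ge> 0" "w \<noteq> 0" "q s \<noteq> 0" by auto
    have pc: "pdet (c s) = (s * w / q s) * (s * w)"
      using t(3) by (simp add: c_def pdet_scale q_def[symmetric] power2_eq_square)
    have "admissible F (c s) (pdet (c s))"
      unfolding pc unfolding c_def
      using admissible_scale[OF admissible_add[OF u admissible_scale[OF w, of s]] t(1)] s by simp
    moreover have "c s \<noteq> 0"
    proof
      assume "c s = 0"
      then have "pdet (c s) = 0" by (simp add: pdet_def)
      then show False using pc t s by simp
    qed
    ultimately show "c s \<noteq> 0 \<and> admissible F (c s) (pdet (c s))" by simp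
  next
    fix x y :: real assume xy: "(x, y) \<noteq> (0, 0)"
    \<comment> \<open>Multiplied by \<open>q s\<close>, the equation becomes quadratic in
      \<open>s\<close>; its constant term \<open>- (x * pdet u)\<close> is nonzero.\<close>
    have fin: "finite {s \<in> {0<..<a}. c s $ i - c s $ j = x}" if "x \<noteq> 0" for i j x
    proof (rule finite_subset)
      have "- (x * pdet u) \<noteq> 0" using pos that by auto
      then show "finite {s. - (x * pdet u) + s * (w * (u$i - u$j) - x * B) + s\<^sup>2 * (w * (v$i - v$j) - x * pdet v) = 0}"
        by (rule finite_quadratic_roots)
      show "{s \<in> {0<..<a}. c s $ i - c s $ j = x} \<subseteq> 
        {s. - (x * pdet u) + s * (w * (u$i - u$j) - x * B) + s\<^sup>2 * (w * (v$i - v$j) - x * pdet v) = 0}"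
      proof (rule subsetI, unfold mem_Collect_eq)
        fix s assume s: "s \<in> {0<..<a} \<and> c s $ i - c s $ j = x"
        then have "q s \<noteq> 0" using a(2)[of s] by auto
        have "x = s * w / q s * (u$i + s * v$i - (u$j + s * v$j))"
          using s by (auto simp: c_def right_diff_distrib)
        then have "s * w * (u$i + s * v$i - (u$j + s * v$j)) = x * q s"
          using \<open>q s \<noteq> 0\<close> by simp
        then show "- (x * pdet u) + s * (w * (u$i - u$j) - x * B) + s\<^sup>2 * (w * (v$i - v$j) - x * pdet v) = 0"
          by (simp add: q power2_eq_square algebra_simps)
      qed
    qed
    show "countable {s \<in> {0<..<a}. c s $ 3 - c s $ 1 = x \<and> c s $ 4 - c s $ 2 = y}"
    proof (cases "x = 0")
      case False
      show ?thesis by (rule countable_subset[OF _ countable_finite[OF fin[OF False, of 3 1]]]) auto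
    next
      case True
      then have "y \<noteq> 0" using xy by simp
      show ?thesis by (rule countable_subset[OF _ countable_finite[OF fin[OF \<open>y \<noteq> 0\<close>, of 4 2]]]) auto
    qed
  qed
qed

text \<open>If \<open>pdet\<close> had opposite signs at \<open>u\<close> and \<open>v\<close>, it
  would vanish somewhere on the segment between them, which lies in the slice. That point must be 0,
  so \<open>u\<close> and \<open>v\<close> are opposite up to scaling; but \<open>pdet\<close> is
  even and homogeneous, so it has equal signs there.\<close>

lemma pins_sign:
  assumes F: "\<forall>g\<in>F. constraint g" "countable F" "pins F"
    and u: "admissible F u 0" "u \<noteq> 0"
  obtains \<sigma> :: real where "\<sigma> \<noteq> 0"
    "\<And>v. admissible F v 0 \<Longrightarrow> v \<noteq> 0 \<Longrightarrow> \<sigma> * pdet v > 0"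
    "\<And>v w. admissible F v w \<Longrightarrow> \<sigma> * w \<le> 0"
proof (rule that[of "pdet u"])
  have nz: "pdet v \<noteq> 0" if "admissible F v 0" "v \<noteq> 0" for v
    using pins_pdet_nonzero[OF F that] .
  show "pdet u \<noteq> 0" using nz u by blast
  show "pdet u * w \<le> 0" if "admissible F v w" for v w
    using pins_same_sign[OF F u(1) that] by (simp add: mult.commute)
  show "pdet u * pdet v > 0" if v: "admissible F v 0" "v \<noteq> 0" for v
  proof (rule ccontr)
    assume "\<not> pdet u * pdet v > 0"
    then have neg: "pdet u * pdet v < 0" using nz[OF v] nz[OF u] by (simp add: not_less order.strict_iff_order)
    define f where "f t = pdet u * pdet ((1 - t) *\<^sub>R u + t *\<^sub>R v)" for t
    have cf: "continuous_on {0..1} f"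
      unfolding f_def pdet_def by (intro continuous_intros)
    have "f 1 \<le> 0" "0 \<le> f 0" using neg by (simp_all add: f_def)
    then obtain t where t: "0 \<le> t" "t \<le> 1" "f t = 0" using IVT2'[of f 1 0 0] cf by auto
    let ?y = "(1 - t) *\<^sub>R u + t *\<^sub>R v"
    have "admissible F ?y 0"
      using admissible_add[OF admissible_scale[OF u(1), of "1 - t"] admissible_scale[OF v(1), of t]] t by simp
    moreover have "pdet ?y = 0" using t(3) nz[OF u] by (simp add: f_def)
    ultimately have "?y = 0" using nz by blast
    then have "(1 - t) *\<^sub>R u = (- t) *\<^sub>R v" by (simp add: eq_neg_iff_add_eq_0)
    then have "(1 - t)\<^sup>2 * pdet u = t\<^sup>2 * pdet v" by (metis pdet_scale power2_minus)
    then have "(1 - t)\<^sup>2 * (pdet u)\<^sup>2 = t\<^sup>2 * (pdet u * pdet v)"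
      by (simp add: power2_eq_square)
    moreover have "t\<^sup>2 * (pdet u * pdet v) \<le> 0" using neg by (simp add: mult_nonneg_nonpos)
    moreover have "(1 - t)\<^sup>2 * (pdet u)\<^sup>2 \<ge> 0" by simp
    ultimately have "(1 - t)\<^sup>2 * (pdet u)\<^sup>2 = 0" "t\<^sup>2 * (pdet u * pdet v) = 0" by linarith+
    then show False using neg nz[OF u] by auto
  qed
qed

section \<open>Finiteness and positive relations\<close>

text \<open>The unit vectors with \<open>\<sigma> * pdet u \<le> 0\<close> form a compact set
  without a point common to all half-spaces \<open>H g\<close>, so finitely many half-spaces already
  exclude it. Homogeneity extends this to all nonzero vectors.\<close>

lemma finite_subset_sign:
  assumes K0: "\<And>u. admissible F u 0 \<Longrightarrow> u \<noteq> 0 \<Longrightarrow> \<sigma> * pdet u > 0"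
  obtains A where "finite A" "A \<subseteq> F"
    "\<And>u. admissible A u 0 \<Longrightarrow> u \<noteq> 0 \<Longrightarrow> \<sigma> * pdet u > 0"
proof -
  define S where "S = sphere 0 1 \<inter> {u. \<sigma> * pdet u \<le> 0}"
  define H where "H g = {u. normal g \<bullet> u \<le> 0}" for g
  have "closed {u. \<sigma> * pdet u \<le> 0}"
    by (rule closed_Collect_le[OF continuous_on_mult_left[OF continuous_pdet] continuous_on_const])
  then have S: "compact S" unfolding S_def using compact_sphere by (rule compact_Int_closed[rotated])
  have H: "closed (H g)" for g
    unfolding H_def by (rule closed_halfspace_le)
  have "\<exists>A. finite A \<and> A \<subseteq> F \<and> S \<inter> \<Inter>(H ` A) = {}"
  proof (rule ccontr)
    assume "\<not> ?thesis"
    then have ne: "S \<inter> \<Inter>(H ` A) \<noteq> {}" if "finite A" "A \<subseteq> F" for A using that by blast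
    have "S \<inter> \<Inter>(H ` F) \<noteq> {}"
      by (rule compact_imp_fip_image[OF S H ne])
    then obtain u where "u \<in> S" "\<forall>g\<in>F. u \<in> H g" by auto
    moreover have "u \<noteq> 0" using \<open>u \<in> S\<close> by (auto simp: S_def)
    ultimately show False using K0[of u] by (auto simp: S_def H_def admissible_def)
  qed
  then obtain A where A: "finite A" "A \<subseteq> F" "S \<inter> \<Inter>(H ` A) = {}" by blast
  show ?thesis
  proof (rule that[OF A(1,2)], rule ccontr)
    fix u assume u: "admissible A u 0" "u \<noteq> 0"
    assume n: "\<not> \<sigma> * pdet u > 0"
    define v where "v = (1 / norm u) *\<^sub>R u"
    have "admissible A v (1 / norm u * 0)" unfolding v_def using u(1) by (rule admissible_scale) simp
    then have "v \<in> \<Inter>(H ` A)" by (auto simp: admissible_def H_def)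
    moreover have "\<sigma> * pdet v = (1 / norm u)\<^sup>2 * (\<sigma> * pdet u)" by (simp add: v_def pdet_scale)
    then have "\<sigma> * pdet v \<le> 0" using n by (metis mult_nonneg_nonpos not_less zero_le_power2)
    then have "v \<in> S" using u(2) by (simp add: S_def v_def)
    ultimately show False using A(3) by blast
  qed
qed

text \<open>Helly's argument: if each of seven constraints were needed for \<open>\<sigma> * w \<le> 0\<close>, a Radon point of the
  seven witnesses would satisfy all constraints.\<close>

lemma finite_if_minimal:
  assumes F: "\<forall>g\<in>F. constraint g" and min: "minimal_pinning F"
    and K0: "\<And>u. admissible F u 0 \<Longrightarrow> u \<noteq> 0 \<Longrightarrow> \<sigma> * pdet u > 0"
    and K: "\<And>u w. admissible F u w \<Longrightarrow> \<sigma> * w \<le> 0"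
  shows "finite F"
proof (rule ccontr)
  assume inf: "infinite F"
  obtain A where A: "finite A" "A \<subseteq> F"
    "\<And>u. admissible A u 0 \<Longrightarrow> u \<noteq> 0 \<Longrightarrow> \<sigma> * pdet u > 0"
    by (rule finite_subset_sign[OF K0]) auto
  \<comment> \<open>\<open>A\<close> alone secures the sign on the slice, so removing
    \<open>g\<close> can destroy pinning only through the bound on \<open>w\<close>.\<close>
  have "\<exists>x. admissible (F - {g}) (fst x) (snd x) \<and> \<sigma> * snd x > 0" if g: "g \<in> F - A" for g
  proof (rule ccontr)
    assume n: "\<not> ?thesis"
    have "pins (F - {g})"
    proof (rule pins_if_admissible)
      show "\<sigma> * pdet u > 0" if "admissible (F - {g}) u 0" "u \<noteq> 0" for u
        by (rule A(3)[OF admissible_mono[OF that(1)] that(2)]) (use A(2) g in blast)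
      show "\<sigma> * w \<le> 0" if "admissible (F - {g}) u w" for u w
        using n that by (auto simp: not_less)
    qed (use F in blast)
    then show False using min g by (auto simp: minimal_pinning_def)
  qed
  then obtain x where x: "\<And>g. g \<in> F - A \<Longrightarrow> admissible (F - {g}) (fst (x g)) (snd (x g))"
    "\<And>g. g \<in> F - A \<Longrightarrow> \<sigma> * snd (x g) > 0" by metis
  have "infinite (F - A)" using inf A(1) by simp
  \<comment> \<open>Seven is the dimension of R^4 x R plus 2, as Radon's theorem demands.\<close>
  then obtain S where S: "S \<subseteq> F - A" "finite S" "card S = 7"
    using infinite_arbitrarily_large by blast
  define C where "C h = {y::(real^4)\<times>real. admissible {h} (fst y) (snd y)}" for h
  have C: "convex (C h)" for h
  proof -
    have "C h = {y. (normal h, - slope h) \<bullet> y \<le> 0}"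
      by (auto simp: C_def admissible_def inner_prod_def)
    then show ?thesis by (simp add: convex_halfspace_le)
  qed
  have xC: "x g \<in> C h" if "g \<in> S" "h \<in> F" "h \<noteq> g" for g h
    using x(1)[of g] that S(1) by (auto simp: C_def admissible_def)
  have nxC: "x g \<notin> C g" if "g \<in> S" for g
  proof
    assume "x g \<in> C g"
    then have "admissible F (fst (x g)) (snd (x g))"
      using x(1)[of g] that S(1) by (auto simp: C_def admissible_def)
    then have "\<sigma> * snd (x g) \<le> 0" by (rule K)
    then show False using x(2)[of g] that S(1) by auto
  qed
  have "inj_on x S"
  proof (rule inj_onI, rule ccontr)
    fix g h assume "g \<in> S" "h \<in> S" "x g = x h" "g \<noteq> h"
    then show False using xC[of h g] nxC[of g] S(1) by auto
  qed
  then have "card (x ` S) = 7" using S(3) by (simp add: card_image)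
  then have "affine_dependent (x ` S)"
    using S(2) by (intro affine_dependent_biggerset) auto
  then obtain M P where MP: "M \<subseteq> x ` S" "P \<subseteq> x ` S" "M \<inter> P = {}" "convex hull M \<inter> convex hull P \<noteq> {}"
    using Radon by metis
  then obtain y where y: "y \<in> convex hull M" "y \<in> convex hull P" by blast
  have "y \<in> C h" if h: "h \<in> F" for h
  proof -
    \<comment> \<open>Every witness except possibly \<open>x h\<close> lies in \<open>C h\<close>.
      As \<open>M\<close> and \<open>P\<close> are disjoint, one of them avoids \<open>x h\<close>,
      and its hull lies in \<open>C h\<close>.\<close>
    have *: "y \<in> C h" if Q: "Q \<subseteq> x ` S" "h \<notin> S \<or> x h \<notin> Q" "y \<in> convex hull Q" for Q
    proof -
      have "Q \<subseteq> C h"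
      proof
        fix q assume q: "q \<in> Q"
        then obtain g where "g \<in> S" "q = x g" using Q(1) by blast
        then show "q \<in> C h" using xC[of g h] h q Q(2) by auto
      qed
      then have "convex hull Q \<subseteq> C h" using C by (rule hull_minimal)
      then show ?thesis using Q(3) by blast
    qed
    show ?thesis using *[of M] *[of P] MP y by blast
  qed
  then have "admissible F (fst y) (snd y)" by (auto simp: C_def admissible_def)
  then have "\<sigma> * snd y \<le> 0" by (rule K)
  have "convex {y::(real^4)\<times>real. \<sigma> * snd y > 0}"
  proof -
    have "{y::(real^4)\<times>real. \<sigma> * snd y > 0} = {y. (0, \<sigma>) \<bullet> y > 0}" by (auto simp: inner_prod_def)
    then show ?thesis by (simp add: convex_halfspace_gt)
  qed
  moreover have "M \<subseteq> {y. \<sigma> * snd y > 0}"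
  proof
    fix m assume "m \<in> M"
    then obtain g where "g \<in> F - A" "m = x g" using MP(1) S(1) by blast
    then show "m \<in> {y. \<sigma> * snd y > 0}" using x(2)[of g] by simp
  qed
  ultimately have "convex hull M \<subseteq> {y. \<sigma> * snd y > 0}"
    by (intro hull_minimal)
  with \<open>\<sigma> * snd y \<le> 0\<close> show False using y(1) by auto
qed

section \<open>Farkas' lemma and Caratheodory's theorem for cones\<close>

text \<open>A finitely generated cone is closed, so a \<open>z\<close> outside it is strictly
  separated from it; the separating normal, negated, violates the hypothesis.\<close>

lemma farkas:
  fixes p :: "'a \<Rightarrow> 'b::euclidean_space"
  assumes F: "finite F" and z: "\<And>y. (\<And>g. g \<in> F \<Longrightarrow> p g \<bullet> y \<le> 0) \<Longrightarrow> z \<bullet> y \<le> 0"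
  obtains c where "\<forall>g\<in>F. c g \<ge> (0::real)" "(\<Sum>g\<in>F. c g *\<^sub>R p g) = z"
proof -
  let ?H = "convex_cone hull (p ` F)"
  define T where "T = {\<Sum>g\<in>F. c g *\<^sub>R p g | c. \<forall>g\<in>F. c g \<ge> (0::real)}"
  have "convex_cone T" unfolding convex_cone_iff
  proof (intro conjI ballI allI impI)
    show "0 \<in> T" unfolding T_def by (intro CollectI exI[of _ "\<lambda>_. 0"]) simp
  next
    fix x y assume "x \<in> T" "y \<in> T"
    then obtain c d where "x = (\<Sum>g\<in>F. c g *\<^sub>R p g)" "y = (\<Sum>g\<in>F. d g *\<^sub>R p g)"
      "\<forall>g\<in>F. c g \<ge> 0" "\<forall>g\<in>F. d g \<ge> 0" by (auto simp: T_def)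
    then show "x + y \<in> T" unfolding T_def
      by (intro CollectI exI[of _ "\<lambda>g. c g + d g"]) (simp add: sum.distrib scaleR_left_distrib)
  next
    fix x and k :: real assume "x \<in> T" "k \<ge> 0"
    then obtain c where "x = (\<Sum>g\<in>F. c g *\<^sub>R p g)" "\<forall>g\<in>F. c g \<ge> 0" by (auto simp: T_def)
    then show "k *\<^sub>R x \<in> T" unfolding T_def using \<open>k \<ge> 0\<close>
      by (intro CollectI exI[of _ "\<lambda>g. k * c g"]) (simp add: scaleR_sum_right)
  qed
  moreover have "p ` F \<subseteq> T"
  proof
    fix x assume "x \<in> p ` F"
    then obtain h where h: "h \<in> F" "x = p h" by blast
    then have "x = (\<Sum>g\<in>F. (if g = h then 1 else 0) *\<^sub>R p g)"
      using F by (simp add: if_distrib[of "\<lambda>t. t *\<^sub>R _"] sum.delta cong: if_cong)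
    then show "x \<in> T" unfolding T_def by (intro CollectI exI[of _ "\<lambda>g. if g = h then 1 else 0"]) simp
  qed
  ultimately have HT: "?H \<subseteq> T" by (intro hull_minimal)
  have "z \<in> ?H"
  proof (rule ccontr)
    assume "z \<notin> ?H"
    moreover have "closed ?H" using F by (intro closed_convex_cone_hull) simp
    ultimately obtain a b where ab: "a \<bullet> z < b" "\<forall>x\<in>?H. a \<bullet> x > b"
      using separating_hyperplane_closed_point[OF convex_convex_cone_hull] by blast
    have b: "b < 0" using ab(2) convex_cone_hull_contains_0[of "p ` F"] by force
    have "p g \<bullet> (- a) \<le> 0" if g: "g \<in> F" for g
    proof (rule ccontr)
      assume "\<not> p g \<bullet> (- a) \<le> 0"
      then have neg: "a \<bullet> p g < 0" by (simp add: inner_commute)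
      \<comment> \<open>This nonnegative multiple of \<open>p g\<close> has inner product exactly
        \<open>b\<close> with \<open>a\<close>, against the strict separation.\<close>
      have "(b / (a \<bullet> p g)) *\<^sub>R p g \<in> ?H"
        using neg b g by (intro convex_cone_hull_mul hull_inc) (auto simp: divide_nonpos_neg)
      then show False using ab(2) neg by force
    qed
    then have "z \<bullet> (- a) \<le> 0" by (rule z)
    then show False using ab(1) b by (simp add: inner_commute)
  qed
  then show ?thesis using HT that unfolding T_def by blast
qed

text \<open>A relation among the vectors is subtracted from the combination until a coefficient
  reaches 0; the rest is induction on the smaller set. Independence is stated for the indexed
  family, so repeated vectors are excluded too.\<close>

lemma conic_caratheodory:
  fixes p :: "'a \<Rightarrow> 'b::real_vector" and c :: "'a \<Rightarrow> real"
  assumes "finite F" "\<And>g. g \<in> F \<Longrightarrow> c g \<ge> 0" "(\<Sum>g\<in>F. c g *\<^sub>R p g) = z"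
  shows "\<exists>B c. B \<subseteq> F \<and> (\<forall>g\<in>B. c g > 0) \<and> (\<Sum>g\<in>B. c g *\<^sub>R p g) = z \<and>
    (\<forall>a. (\<Sum>g\<in>B. a g *\<^sub>R p g) = 0 \<longrightarrow> (\<forall>g\<in>B. a g = 0))"
  using assms
proof (induction F arbitrary: c rule: finite_psubset_induct)
  case (psubset F)
  have reduce: ?case if h: "h \<in> F" "d h = 0" and d: "\<And>g. g \<in> F \<Longrightarrow> d g \<ge> 0" "(\<Sum>g\<in>F. d g *\<^sub>R p g) = z" for d h
  proof -
    have "(\<Sum>g\<in>F - {h}. d g *\<^sub>R p g) = z"
      using h d(2) psubset.hyps by (subst (asm) sum.remove[of F h]) auto
    moreover have "F - {h} \<subset> F" using h(1) by blast
    ultimately have "\<exists>B c. B \<subseteq> F - {h} \<and> (\<forall>g\<in>B. c g > 0) \<and> (\<Sum>g\<in>B. c g *\<^sub>R p g) = z \<and>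
      (\<forall>a. (\<Sum>g\<in>B. a g *\<^sub>R p g) = 0 \<longrightarrow> (\<forall>g\<in>B. a g = 0))"
      using d(1) by (intro psubset.IH[of "F - {h}" d]) auto
    then obtain B c' where B: "B \<subseteq> F - {h}" and c': "(\<forall>g\<in>B. c' g > 0) \<and> (\<Sum>g\<in>B. c' g *\<^sub>R p g) = z \<and>
      (\<forall>a. (\<Sum>g\<in>B. a g *\<^sub>R p g) = 0 \<longrightarrow> (\<forall>g\<in>B. a g = 0))" by (elim exE conjE) (rule that, auto)
    from B have "B \<subseteq> F" by blast
    with c' show ?thesis by (intro exI[of _ B] exI[of _ c'] conjI) simp_all
  qed
  show ?case
  proof (cases "\<exists>h\<in>F. c h = 0")
    case True
    then obtain h where "h \<in> F" "c h = 0" by blast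
    then show ?thesis using psubset.prems by (rule reduce)
  next
    case False
    then have pos: "\<forall>g\<in>F. c g > 0" using psubset.prems(1) by (force simp: order_le_less)
    show ?thesis
    proof (cases "\<forall>a. (\<Sum>g\<in>F. a g *\<^sub>R p g) = 0 \<longrightarrow> (\<forall>g\<in>F. a g = 0)")
      case True
      then show ?thesis using pos psubset.prems(2) by (intro exI[of _ F] exI[of _ c]) simp
    next
      case False
      then obtain a0 h0 where a0: "(\<Sum>g\<in>F. a0 g *\<^sub>R p g) = 0" "h0 \<in> F" "a0 h0 \<noteq> 0" by blast
      \<comment> \<open>The sign makes some coefficient positive, so that a minimal ratio
        exists.\<close>
      define a where "a g = sgn (a0 h0) * a0 g" for g
      have az: "(\<Sum>g\<in>F. a g *\<^sub>R p g) = 0" 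
      proof -
        have "(\<Sum>g\<in>F. a g *\<^sub>R p g) = sgn (a0 h0) *\<^sub>R (\<Sum>g\<in>F. a0 g *\<^sub>R p g)"
          by (simp add: a_def scaleR_sum_right)
        then show ?thesis using a0(1) by simp
      qed
      have ah: "a h0 > 0" using a0(3) by (simp add: a_def sgn_if)
      define P where "P = {g\<in>F. a g > 0}"
      have P: "finite P" "P \<noteq> {}" using psubset.hyps a0(2) ah by (auto simp: P_def)
      \<comment> \<open>At the minimal ratio the coefficient of \<open>h\<close> vanishes while all
        others stay nonnegative.\<close>
      define h where "h = arg_min_on (\<lambda>g. c g / a g) P"
      have h: "h \<in> P" "\<And>g. g \<in> P \<Longrightarrow> c h / a h \<le> c g / a g"
        using arg_min_if_finite[OF P, of "\<lambda>g. c g / a g"] by (auto simp: h_def not_less)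
      define d where "d g = c g - (c h / a h) * a g" for g
      have ahp: "a h > 0" "h \<in> F" using h(1) by (auto simp: P_def)
      have d0: "d g \<ge> 0" if "g \<in> F" for g
      proof (cases "a g > 0")
        case True
        then show ?thesis using h(2)[of g] that by (simp add: d_def P_def field_simps)
      next
        case False
        then have "(c h / a h) * a g \<le> 0" using ahp pos by (intro mult_nonneg_nonpos) auto
        then show ?thesis using pos that by (force simp: d_def)
      qed
      have dh: "d h = 0" using ahp by (simp add: d_def)
      have "(\<Sum>g\<in>F. d g *\<^sub>R p g) = z"
      proof -
        have "(\<Sum>g\<in>F. d g *\<^sub>R p g) = (\<Sum>g\<in>F. c g *\<^sub>R p g) - (c h / a h) *\<^sub>R (\<Sum>g\<in>F. a g *\<^sub>R p g)"
          by (simp add: d_def scaleR_left_diff_distrib sum_subtractf scaleR_sum_right)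
        then show ?thesis using az psubset.prems(2) by simp
      qed
      with ahp(2) dh d0 show ?thesis by (intro reduce[of h d])
    qed
  qed
qed

section \<open>Constraints orthogonal to a skew line\<close>

text \<open>The line of \<open>u\<close> passes through the point (\<open>px u z\<close>, \<open>py u z\<close>, \<open>z\<close>).\<close>

definition px :: "real^4 \<Rightarrow> real \<Rightarrow> real" where
  "px u z = (1 - z) * u$1 + z * u$3"

definition py :: "real^4 \<Rightarrow> real \<Rightarrow> real" where
  "py u z = (1 - z) * u$2 + z * u$4"

text \<open>Up to scaling this is the planar cross product of the direction of \<open>g\<close> with
  the position of the line of \<open>u\<close> at the height of \<open>g\<close>; it is 0 iff
  \<open>perp g\<close> meets that line.\<close>

lemma normal_inner:
  "normal g \<bullet> u = (snd g $ 2 * px u (height g) - snd g $ 1 * py u (height g)) / horiz g"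
  by (simp add: inner_4 normal_components px_def py_def divide_simps) (simp add: algebra_simps)

text \<open>A line with nonzero \<open>pdet\<close> does not meet the axis.\<close>

lemma px_py_nonzero:
  assumes "pdet u \<noteq> 0"
  shows "px u z \<noteq> 0 \<or> py u z \<noteq> 0"
proof (rule ccontr)
  assume "\<not> ?thesis"
  then have z: "px u z = 0" "py u z = 0" by auto
  have "z * pdet u = u$1 * py u z - u$2 * px u z" "(1 - z) * pdet u = u$4 * px u z - u$3 * py u z"
    by (simp_all add: px_def py_def pdet_def algebra_simps)
  then have "z * pdet u = 0" "(1 - z) * pdet u = 0" using z by simp_all
  then show False using assms by auto
qed

lemma normal_orthogonal_direction:
  assumes g: "constraint g" and u: "pdet u \<noteq> 0" "normal g \<bullet> u = 0"
  obtains k where "k \<noteq> 0" "snd g $ 1 = k * px u (height g)" "snd g $ 2 = k * py u (height g)"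
proof -
  let ?x = "px u (height g)" and ?y = "py u (height g)" and ?c = "snd g $ 1" and ?s = "snd g $ 2"
  have h: "horiz g > 0" using constraint_point(2)[OF g] .
  have e: "?s * ?x = ?c * ?y" using u(2) h by (simp add: normal_inner)
  define n where "n = ?x\<^sup>2 + ?y\<^sup>2"
  have n: "n \<noteq> 0" using px_py_nonzero[OF u(1), of "height g"] by (simp add: n_def sum_power2_eq_zero_iff)
  \<comment> \<open>The coefficient of the orthogonal projection onto the vector with components
    \<open>?x\<close> and \<open>?y\<close>.\<close>
  define k where "k = (?c * ?x + ?s * ?y) / n"
  have "(?c * ?x + ?s * ?y) * ?x = ?c * n"
    using arg_cong[OF e, of "\<lambda>t. t * ?y"] by (simp add: n_def power2_eq_square algebra_simps)
  then have c: "?c = k * ?x" using n by (simp add: k_def field_simps)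
  have "(?c * ?x + ?s * ?y) * ?y = ?s * n"
    using arg_cong[OF e[symmetric], of "\<lambda>t. t * ?x"] by (simp add: n_def power2_eq_square algebra_simps)
  then have s: "?s = k * ?y" using n by (simp add: k_def field_simps)
  have "k \<noteq> 0" using c s h by (auto simp: horiz_def)
  then show ?thesis using that c s by blast
qed

lemma degenerate_pairI:
  assumes "constraint g" "constraint h" "height g = height h"
    and par: "snd g $ 1 * snd h $ 2 = snd g $ 2 * snd h $ 1"
  shows "degenerate_pair g h"
proof -
  let ?q = "vector [0, 0, height g] :: real^3"
  \<comment> \<open>The normal of the vertical plane through \<open>ell0\<close> and
    \<open>g\<close>.\<close>
  define n :: "real^3" where "n = vector [snd g $ 2, - (snd g $ 1), 0]"
  have "n \<noteq> 0" using constraint_point(2)[OF assms(1)] by (auto simp: n_def vec_eq_iff forall_3 horiz_def)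
  moreover have q: "?q \<in> line_points g" "?q \<in> line_points h" "?q \<in> line_points ell0"
    using constraint_point(1)[OF assms(1)] constraint_point(1)[OF assms(2)] assms(3)
    by (simp_all add: line_points_ell0)
  moreover have "line_points ell0 \<subseteq> {x. n \<bullet> x = 0}"
    by (auto simp: line_points_ell0 n_def inner_3)
  moreover have "line_points g \<subseteq> {x. n \<bullet> x = 0}"
    by (auto simp: line_points_shift[OF q(1)] n_def inner_3 algebra_simps)
  moreover have "line_points h \<subseteq> {x. n \<bullet> x = 0}"
    using par by (auto simp: line_points_shift[OF q(2)] n_def inner_3 algebra_simps)
  ultimately show ?thesis unfolding degenerate_pair_def by blast
qed

text \<open>At equal heights both horizontal directions are multiples of the same position vector,
  so the pair is degenerate.\<close>

lemma inj_on_height: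
  assumes F: "\<forall>g\<in>F. constraint g"
    and nd: "\<forall>g1\<in>F. \<forall>g2\<in>F. g1 \<noteq> g2 \<longrightarrow> \<not> degenerate_pair g1 g2"
    and u: "pdet u \<noteq> 0" "\<And>g. g \<in> F \<Longrightarrow> normal g \<bullet> u = 0"
  shows "inj_on height F"
proof (rule inj_onI, rule ccontr)
  fix g h assume gh: "g \<in> F" "h \<in> F" "height g = height h" "g \<noteq> h"
  obtain k where k: "snd g $ 1 = k * px u (height g)" "snd g $ 2 = k * py u (height g)"
    using normal_orthogonal_direction[of g u] F gh u by metis
  obtain l where l: "snd h $ 1 = l * px u (height h)" "snd h $ 2 = l * py u (height h)"
    using normal_orthogonal_direction[of h u] F gh u by metis
  have "degenerate_pair g h"
    using F gh k l by (intro degenerate_pairI) auto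
  then show False using nd gh by blast
qed

section \<open>Linear independence of normals orthogonal to \<open>u\<close>\<close>

text \<open>A Vandermonde argument: the weights are tested against the quadratic with roots
  \<open>s\<close> and \<open>t\<close>, which vanishes at every point other than
  \<open>x g\<close>. With fewer than two other points a root is doubled.\<close>

lemma quadratic_moments_zero:
  fixes b x :: "'a \<Rightarrow> real"
  assumes B: "finite B" "card B \<le> 3" "inj_on x B"
    and m: "(\<Sum>g\<in>B. b g) = 0" "(\<Sum>g\<in>B. b g * x g) = 0" "(\<Sum>g\<in>B. b g * (x g)\<^sup>2) = 0"
    and g: "g \<in> B"
  shows "b g = 0"
proof -
  have "card (B - {g}) \<le> 2" using B(1,2) g by simp
  then consider "B - {g} = {}" | h where "B - {g} = {h}" | h h' where "B - {g} = {h, h'}"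
    using B(1) by (metis Suc_1 card_0_eq card_1_singletonE card_2_iff finite_Diff le_0_eq le_SucE One_nat_def)
  then obtain s t where st: "\<And>h. h \<in> B - {g} \<Longrightarrow> x h = s \<or> x h = t" "x g \<noteq> s" "x g \<noteq> t"
  proof cases
    case 1
    then show ?thesis using that[of "x g + 1" "x g + 1"] by auto
  next
    case (2 h)
    then have "x g \<noteq> x h" using B(3) g by (auto simp: inj_on_def)
    then show ?thesis using 2 that[of "x h" "x h"] by auto
  next
    case (3 h h')
    then have "x g \<noteq> x h" "x g \<noteq> x h'" using B(3) g by (auto simp: inj_on_def)
    then show ?thesis using 3 that[of "x h" "x h'"] by auto
  qed
  have "(\<Sum>h\<in>B. b h * ((x h - s) * (x h - t)))
    = (\<Sum>h\<in>B. b h * (x h)\<^sup>2) - (s + t) * (\<Sum>h\<in>B. b h * x h) + s * t * (\<Sum>h\<in>B. b h)"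
    by (simp add: sum_distrib_left sum_subtractf[symmetric] sum.distrib[symmetric])
      (rule sum.cong, simp_all add: power2_eq_square algebra_simps)
  then have "(\<Sum>h\<in>B. b h * ((x h - s) * (x h - t))) = 0" using m by simp
  moreover have "(\<Sum>h\<in>B - {g}. b h * ((x h - s) * (x h - t))) = 0"
    using st(1) by (intro sum.neutral) auto
  ultimately have "b g * ((x g - s) * (x g - t)) = 0"
    using B(1) g by (simp add: sum.remove)
  then show ?thesis using st by simp
qed

text \<open>The direction of \<open>g\<close> is a multiple of (\<open>px\<close>,
  \<open>py\<close>), so up to scaling its normal is quadratic in the height. A relation yields two
  linear systems of determinant \<open>pdet u\<close> (up to sign) for the moments \<open>X\<close>,
  \<open>Y\<close>, \<open>Z\<close>; these therefore vanish, and with them all moments of degree at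
  most 2.\<close>

lemma normal_relation_zero:
  assumes F: "\<forall>g\<in>B. constraint g" and B: "finite B" "card B \<le> 3" "inj_on height B"
    and u: "pdet u \<noteq> 0" "\<And>g. g \<in> B \<Longrightarrow> normal g \<bullet> u = 0"
    and a: "(\<Sum>g\<in>B. a g *\<^sub>R normal g) = 0" and g: "g \<in> B"
  shows "a g = 0"
proof -
  have "\<exists>k. k \<noteq> 0 \<and> snd g $ 1 = k * px u (height g) \<and> snd g $ 2 = k * py u (height g)" if "g \<in> B" for g
    using normal_orthogonal_direction[of g u] F that u by metis
  then obtain k where k: "\<And>g. g \<in> B \<Longrightarrow> k g \<noteq> 0" "\<And>g. g \<in> B \<Longrightarrow> snd g $ 1 = k g * px u (height g)"
    "\<And>g. g \<in> B \<Longrightarrow> snd g $ 2 = k g * py u (height g)" by metis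
  define m where "m g = k g / horiz g" for g
  have n: "normal g $ 1 = (1 - height g) * (m g * py u (height g))"
    "normal g $ 2 = (height g - 1) * (m g * px u (height g))"
    "normal g $ 3 = height g * (m g * py u (height g))"
    "normal g $ 4 = - (height g * (m g * px u (height g)))" if "g \<in> B" for g
    using that by (simp_all add: normal_components k m_def)
  define b where "b g = a g * m g" for g
  define X where "X = (\<Sum>g\<in>B. b g * (1 - height g)\<^sup>2)"
  define Y where "Y = (\<Sum>g\<in>B. b g * ((1 - height g) * height g))"
  define Z where "Z = (\<Sum>g\<in>B. b g * (height g)\<^sup>2)"
  have comp: "(\<Sum>g\<in>B. a g * normal g $ i) = 0" for i
    using arg_cong[OF a, of "\<lambda>v. v $ i"] by simp
  have s1: "(\<Sum>g\<in>B. a g * normal g $ 1) = u$2 * X + u$4 * Y"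
    unfolding X_def Y_def sum_distrib_left sum.distrib[symmetric]
    by (rule sum.cong) (simp_all add: n b_def py_def power2_eq_square algebra_simps)
  have s2: "(\<Sum>g\<in>B. a g * normal g $ 2) = - (u$1 * X + u$3 * Y)"
    unfolding X_def Y_def sum_distrib_left sum.distrib[symmetric] sum_negf[symmetric]
    by (rule sum.cong) (simp_all add: n b_def px_def power2_eq_square algebra_simps)
  have s3: "(\<Sum>g\<in>B. a g * normal g $ 3) = u$2 * Y + u$4 * Z"
    unfolding Z_def Y_def sum_distrib_left sum.distrib[symmetric]
    by (rule sum.cong) (simp_all add: n b_def py_def power2_eq_square algebra_simps)
  have s4: "(\<Sum>g\<in>B. a g * normal g $ 4) = - (u$1 * Y + u$3 * Z)"
    unfolding Z_def Y_def sum_distrib_left sum.distrib[symmetric] sum_negf[symmetric]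
    by (rule sum.cong) (simp_all add: n b_def px_def power2_eq_square algebra_simps)
  have e: "u$2 * X + u$4 * Y = 0" "u$1 * X + u$3 * Y = 0" "u$2 * Y + u$4 * Z = 0" "u$1 * Y + u$3 * Z = 0"
    using s1 s2 s3 s4 unfolding comp by linarith+
  have "pdet u * X = u$4 * (u$1 * X + u$3 * Y) - u$3 * (u$2 * X + u$4 * Y)"
    "pdet u * Y = u$4 * (u$1 * Y + u$3 * Z) - u$3 * (u$2 * Y + u$4 * Z)"
    "pdet u * Z = u$1 * (u$2 * Y + u$4 * Z) - u$2 * (u$1 * Y + u$3 * Z)"
    by (simp_all add: pdet_def algebra_simps)
  then have "pdet u * X = 0" "pdet u * Y = 0" "pdet u * Z = 0" unfolding e by simp_all
  then have XYZ: "X = 0" "Y = 0" "Z = 0" using u(1) by simp_all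
  have "(\<Sum>g\<in>B. b g * height g) = Y + Z"
    unfolding Y_def Z_def sum.distrib[symmetric]
    by (rule sum.cong) (simp_all add: power2_eq_square algebra_simps)
  then have b1: "(\<Sum>g\<in>B. b g * height g) = 0" using XYZ by simp
  have "(\<Sum>g\<in>B. b g) = X + 2 * Y + Z"
    unfolding X_def Y_def Z_def sum_distrib_left sum.distrib[symmetric]
    by (rule sum.cong) (simp_all add: power2_eq_square algebra_simps)
  then have b0: "(\<Sum>g\<in>B. b g) = 0" using XYZ by simp
  have "b g = 0"
    using quadratic_moments_zero[OF B b0 b1 XYZ(3)[unfolded Z_def] g] .
  then show ?thesis using k(1)[OF g] constraint_point(2)[of g] F g by (auto simp: b_def m_def)
qed

text \<open>The planar cross product of the positions of the lines of \<open>u\<close> and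
  \<open>v\<close> is a polynomial of degree at most 2 in the height. It vanishes at three heights,
  hence identically, and this makes \<open>v\<close> proportional to \<open>u\<close>.\<close>

lemma common_orthogonal:
  assumes F: "\<forall>g\<in>B. constraint g" and B: "finite B" "card B \<ge> 3" "inj_on height B"
    and u: "pdet u \<noteq> 0" "\<And>g. g \<in> B \<Longrightarrow> normal g \<bullet> u = 0"
    and v: "\<And>g. g \<in> B \<Longrightarrow> normal g \<bullet> v = 0"
  obtains t where "v = t *\<^sub>R u"
proof -
  define a0 where "a0 = u$1 * v$2 - u$2 * v$1"
  define a1 where "a1 = u$1 * v$4 - u$2 * v$3 + u$3 * v$2 - u$4 * v$1"
  define a2 where "a2 = u$3 * v$4 - u$4 * v$3"
  \<comment> \<open>\<open>a0\<close>, \<open>a1\<close>, \<open>a2\<close> are the coefficients at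
    \<open>(1 - z)\<^sup>2\<close>, \<open>(1 - z) * z\<close>, \<open>z\<^sup>2\<close>, rewritten
    in powers of \<open>z\<close>.\<close>
  let ?p = "[:a0, a1 - 2 * a0, a0 - a1 + a2:]"
  have p: "poly ?p z = px u z * py v z - py u z * px v z" for z
    by (simp add: px_def py_def a0_def a1_def a2_def algebra_simps)
  have "poly ?p (height g) = 0" if g: "g \<in> B" for g
  proof -
    obtain k where k: "k \<noteq> 0" "snd g $ 1 = k * px u (height g)" "snd g $ 2 = k * py u (height g)"
      using normal_orthogonal_direction[of g u] F g u by metis
    have "horiz g \<noteq> 0" using constraint_point(2)[of g] F g by auto
    then have "k * (py u (height g) * px v (height g) - px u (height g) * py v (height g)) = 0"
      using v[OF g] by (simp add: normal_inner k algebra_simps)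
    then show ?thesis using k(1) unfolding p by simp
  qed
  then have sub: "height ` B \<subseteq> {z. poly ?p z = 0}" by blast
  have "?p = 0"
  proof (rule ccontr)
    assume nz: "?p \<noteq> 0"
    have "card (height ` B) \<le> card {z. poly ?p z = 0}"
      using sub poly_roots_finite[OF nz] by (rule card_mono[rotated])
    also have "\<dots> \<le> degree ?p" using nz by (rule card_poly_roots_bound)
    also have "\<dots> \<le> 2" by (simp add: degree_pCons_eq_if)
    finally show False using B by (simp add: card_image)
  qed
  then have a: "a0 = 0" "a1 = 0" "a2 = 0" by auto
  define t where "t = (v$1 * u$4 - v$2 * u$3) / pdet u"
  have "pdet u * v$1 = (v$1 * u$4 - v$2 * u$3) * u$1"
    using a(1) by (simp add: a0_def pdet_def algebra_simps)
  moreover have "pdet u * v$2 = (v$1 * u$4 - v$2 * u$3) * u$2"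
    using a(1) unfolding a0_def pdet_def by algebra
  moreover have "pdet u * v$3 = (v$1 * u$4 - v$2 * u$3) * u$3"
    using a unfolding a0_def a1_def a2_def pdet_def by algebra
  moreover have "pdet u * v$4 = (v$1 * u$4 - v$2 * u$3) * u$4"
    using a unfolding a0_def a1_def a2_def pdet_def by algebra
  ultimately have "v = t *\<^sub>R u"
    using u(1) by (simp add: vec_eq_iff forall_4 t_def field_simps)
  then show ?thesis using that by blast
qed

section \<open>The ruled quadric\<close>

lemma hyperboloidal_perp:
  assumes F: "\<forall>g\<in>F. constraint g"
    and u: "pdet u \<noteq> 0" "\<And>g. g \<in> F \<Longrightarrow> normal g \<bullet> u = 0"
  shows "hyperboloidal (perp ` F)"
proof -
  define vx where "vx = u$3 - u$1"
  define vy where "vy = u$4 - u$2"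
  \<comment> \<open>The symmetric matrix of twice the form
    \<open>x$1 * py u (x$3) - x$2 * px u (x$3)\<close>, whose zeros are the points of the lines
    \<open>L z\<close>.\<close>
  define M :: "real^4^4" where "M = vector [vector [0, 0, vy, u$2], vector [0, 0, - vx, - (u$1)],
    vector [vy, - vx, 0, 0], vector [u$2, - (u$1), 0, 0]]"
  define L where "L z = (vector [0, 0, z] :: real^3, vector [px u z, py u z, 0] :: real^3)" for z
  define R where "R = (\<lambda>z. line_points (L z)) ` UNIV"
  have d: "pdet u = u$1 * vy - u$2 * vx" by (simp add: pdet_def vx_def vy_def algebra_simps)
  have pz: "px u z = u$1 + z * vx" "py u z = u$2 + z * vy" for z
    by (simp_all add: px_def py_def vx_def vy_def algebra_simps)
  have mem: "x \<in> line_points (L z) \<longleftrightarrow> x$3 = z \<and> x$1 * py u z = x$2 * px u z" for x z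
  proof
    assume "x \<in> line_points (L z)"
    then show "x$3 = z \<and> x$1 * py u z = x$2 * px u z" by (auto simp: line_points_iff L_def)
  next
    assume x: "x$3 = z \<and> x$1 * py u z = x$2 * px u z"
    from px_py_nonzero[OF u(1), of z] show "x \<in> line_points (L z)"
    proof
      assume "px u z \<noteq> 0"
      then have "x = fst (L z) + (x$1 / px u z) *\<^sub>R snd (L z)"
        using x by (simp add: L_def vec_eq_iff forall_3 field_simps)
      then show ?thesis unfolding line_points_iff ..
    next
      assume "py u z \<noteq> 0"
      then have "x = fst (L z) + (x$2 / py u z) *\<^sub>R snd (L z)"
        using x by (simp add: L_def vec_eq_iff forall_3 field_simps)
      then show ?thesis unfolding line_points_iff ..
    qed
  qed
  have quad: "x \<in> quadric M \<longleftrightarrow> x$1 * py u (x$3) = x$2 * px u (x$3)" for x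
  proof -
    have "hom x \<bullet> (M *v hom x) = 2 * (x$1 * py u (x$3) - x$2 * px u (x$3))"
      by (simp add: inner_4 matrix_vector_mult_def sum_4 hom_def M_def pz algebra_simps)
    then show ?thesis by (simp add: quadric_def)
  qed
  have "transpose M = M"
    by (simp add: transpose_def M_def vec_eq_iff forall_4)
  moreover have "det M \<noteq> 0"
  proof -
    have "x = 0" if "M *v x = 0" for x
    proof -
      have "vy * x$3 + u$2 * x$4 = 0" "vx * x$3 + u$1 * x$4 = 0"
        "vy * x$1 = vx * x$2" "u$2 * x$1 = u$1 * x$2"
        using that by (simp_all add: vec_eq_iff forall_4 matrix_vector_mult_def sum_4 M_def)
      then have "pdet u * x$1 = 0" "pdet u * x$2 = 0" "pdet u * x$3 = 0" "pdet u * x$4 = 0"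
        unfolding d by algebra+
      then show "x = 0" using u(1) by (simp add: vec_eq_iff forall_4)
    qed
    then have "\<exists>B. B ** M = mat 1" unfolding matrix_left_invertible_ker by blast
    then show ?thesis by (metis invertible_det_nz invertible_left_inverse)
  qed
  moreover have "ruling_family (quadric M) R" unfolding ruling_family_def
  proof (intro conjI ballI)
    fix r assume "r \<in> R"
    then obtain z where r: "r = line_points (L z)" by (auto simp: R_def)
    have "valid_line (L z)" using px_py_nonzero[OF u(1), of z]
      by (auto simp: valid_line_def L_def vec_eq_iff exists_3)
    then show "\<exists>L. valid_line L \<and> r = line_points L" using r by blast
    show "r \<subseteq> quadric M" using r mem quad by auto
  next
    fix x assume "x \<in> quadric M"
    \<comment> \<open>All rulings \<open>L z\<close> are horizontal, so the only one through
      \<open>x\<close> is at height \<open>x$3\<close>.\<close>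
    then show "\<exists>!r. r \<in> R \<and> x \<in> r" using mem quad by (auto simp: R_def)
  qed
  moreover have "line_points g \<in> R" if "g \<in> perp ` F" for g
  proof -
    obtain h where h: "h \<in> F" "g = perp h" using \<open>g \<in> perp ` F\<close> by blast
    obtain k where k: "k \<noteq> 0" "snd h $ 1 = k * px u (height h)" "snd h $ 2 = k * py u (height h)"
      using normal_orthogonal_direction[of h u] F h u by metis
    have "line_points (fst (L (height h)), snd (L (height h))) = line_points (perp h)"
    proof (rule line_points_scale)
      show "1 / k \<noteq> 0" using k(1) by simp
      show "snd (L (height h)) = (1 / k) *\<^sub>R snd (perp h)"
        using k by (simp add: L_def vec_eq_iff forall_3)
      show "fst (L (height h)) \<in> line_points (perp h)"
        unfolding line_points_iff by (rule exI[of _ 0]) (simp add: L_def perp_def)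
    qed
    then show ?thesis using h by (auto simp: R_def)
  qed
  ultimately show ?thesis
    unfolding hyperboloidal_def nondegenerate_quadric_matrix_def by blast
qed

section \<open>Extraction of four pinning constraints\<close>

lemma card_le_dim_if_no_relation:
  fixes p :: "'a \<Rightarrow> 'b::euclidean_space"
  assumes B: "finite B" and ind: "\<And>a g. (\<Sum>g\<in>B. a g *\<^sub>R p g) = 0 \<Longrightarrow> g \<in> B \<Longrightarrow> a g = 0"
    and V: "p ` B \<subseteq> V"
  shows "card B \<le> dim V"
proof -
  have inj: "inj_on p B"
  proof (rule inj_onI, rule ccontr)
    fix g h assume gh: "g \<in> B" "h \<in> B" "p g = p h" "g \<noteq> h"
    let ?a = "\<lambda>x. if x = g then 1 else if x = h then - 1 else (0::real)"
    have "(\<Sum>x\<in>B. ?a x *\<^sub>R p x) = (\<Sum>x\<in>{g, h}. ?a x *\<^sub>R p x)"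
      using B gh by (intro sum.mono_neutral_right) auto
    also have "\<dots> = 0" using gh by simp
    finally show False using ind[of ?a g] gh(1) by simp
  qed
  have "independent (p ` B)"
  proof
    assume "dependent (p ` B)"
    then obtain a v where a: "v \<in> p ` B" "a v \<noteq> 0" "(\<Sum>v\<in>p ` B. a v *\<^sub>R v) = 0"
      using B by (auto simp: dependent_finite)
    then have "(\<Sum>g\<in>B. a (p g) *\<^sub>R p g) = 0" by (simp add: sum.reindex[OF inj])
    then show False using ind[of "a \<circ> p"] a by auto
  qed
  then have "card (p ` B) \<le> dim V" using V by (intro independent_card_le_dim)
  then show ?thesis by (simp add: card_image[OF inj])
qed

text \<open>Pairing the relation with \<open>v\<close> gives a sum of nonpositive terms equal to 0,
  so each term vanishes.\<close>

lemma positive_relation_orthogonal: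
  assumes B: "finite B" "\<And>g. g \<in> B \<Longrightarrow> c g > (0::real)" "(\<Sum>g\<in>B. c g *\<^sub>R normal g) = 0"
    and v: "admissible B v 0" and g: "g \<in> B"
  shows "normal g \<bullet> v = 0"
proof -
  have "(\<Sum>g\<in>B. - (c g * (normal g \<bullet> v))) = - ((\<Sum>g\<in>B. c g *\<^sub>R normal g) \<bullet> v)"
    by (simp add: inner_sum_left sum_negf)
  then have "(\<Sum>g\<in>B. - (c g * (normal g \<bullet> v))) = 0" using B(3) by simp
  moreover have "- (c g * (normal g \<bullet> v)) \<ge> 0" if "g \<in> B" for g
    using v that B(2)[of g] by (auto simp: admissible_def mult_le_0_iff)
  ultimately have "- (c g * (normal g \<bullet> v)) = 0"
    using B(1) g by (simp add: sum_nonneg_eq_0_iff)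
  then show ?thesis using B(2)[OF g] by simp
qed

lemma inj_on_normal:
  assumes F: "\<forall>g\<in>B. constraint g" and B: "inj_on height B"
    and u: "pdet u \<noteq> 0" "\<And>g. g \<in> B \<Longrightarrow> normal g \<bullet> u = 0"
  shows "inj_on normal B"
proof (rule inj_onI, rule ccontr)
  fix g h assume gh: "g \<in> B" "h \<in> B" "normal g = normal h" "g \<noteq> h"
  let ?a = "\<lambda>x. if x = g then 1 else (- 1 :: real)"
  have "?a g = 0"
  proof (rule normal_relation_zero[of "{g, h}" u ?a g])
    show "inj_on height {g, h}" using B gh by (auto simp: inj_on_def)
    show "(\<Sum>x\<in>{g, h}. ?a x *\<^sub>R normal x) = 0" using gh by simp
    show "card {g, h} \<le> 3" using gh(4) by simp
  qed (use F u gh in auto)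
  then show False by simp
qed

text \<open>Subtracting a multiple of \<open>c\<close> from an affine relation \<open>a\<close>
  cancels one coefficient; the other three normals are independent, so \<open>a = t * c\<close> on
  \<open>B\<close>. As \<open>a\<close> sums to 0 and \<open>c\<close> does not,
  \<open>t = 0\<close>. Normalizing \<open>c\<close> puts 0 in the relative interior.\<close>

lemma critical_simplex_normal:
  assumes F: "\<forall>g\<in>B. constraint g" and B: "finite B" "card B = 4" "inj_on height B"
    and u: "pdet u \<noteq> 0" "\<And>g. g \<in> B \<Longrightarrow> normal g \<bullet> u = 0"
    and c: "\<And>g. g \<in> B \<Longrightarrow> c g > (0::real)" "(\<Sum>g\<in>B. c g *\<^sub>R normal g) = 0"
  shows "critical_simplex (normal ` B)"
proof -
  have inj: "inj_on normal B" by (rule inj_on_normal[OF F B(3) u])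
  have ne: "B \<noteq> {}" using B(2) by auto
  then have pos: "sum c B > 0" using B(1) c(1) by (intro sum_pos) auto
  have aff: "\<not> affine_dependent (normal ` B)"
  proof
    assume "affine_dependent (normal ` B)"
    then obtain U v where U: "sum U (normal ` B) = 0" "v \<in> normal ` B" "U v \<noteq> 0"
      "(\<Sum>v\<in>normal ` B. U v *\<^sub>R v) = 0"
      using B(1) by (auto simp: affine_dependent_explicit_finite)
    define a where "a g = U (normal g)" for g
    have a: "(\<Sum>g\<in>B. a g) = 0" "(\<Sum>g\<in>B. a g *\<^sub>R normal g) = 0"
      using U(1,4) by (simp_all add: a_def sum.reindex[OF inj])
    obtain h where h: "h \<in> B" using ne by blast
    define t where "t = a h / c h"
    have th: "a h - t * c h = 0" using c(1)[OF h] by (simp add: t_def)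
    have "(\<Sum>g\<in>B. (a g - t * c g) *\<^sub>R normal g) =
      (\<Sum>g\<in>B. a g *\<^sub>R normal g) - t *\<^sub>R (\<Sum>g\<in>B. c g *\<^sub>R normal g)"
      by (simp add: scaleR_left_diff_distrib sum_subtractf scaleR_sum_right)
    then have "(\<Sum>g\<in>B. (a g - t * c g) *\<^sub>R normal g) = 0" using a(2) c(2) by simp
    then have r: "(\<Sum>g\<in>B - {h}. (a g - t * c g) *\<^sub>R normal g) = 0"
      using th sum.remove[OF B(1) h, of "\<lambda>g. (a g - t * c g) *\<^sub>R normal g"] by simp
    have "a g - t * c g = 0" if "g \<in> B - {h}" for g
    proof (rule normal_relation_zero[of "B - {h}" u "\<lambda>g. a g - t * c g", OF _ _ _ _ u(1) _ r that])
      show "inj_on height (B - {h})" using B(3) by (auto simp: inj_on_def)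
    qed (use F B h u(2) in auto)
    then have at: "a g = t * c g" if "g \<in> B" for g using th that by (cases "g = h") auto
    then have "(\<Sum>g\<in>B. a g) = t * sum c B" by (simp add: sum_distrib_left)
    then have "t = 0" using a(1) pos by simp
    then show False using at U(2,3) by (auto simp: a_def)
  qed
  moreover have ri: "0 \<in> rel_interior (convex hull (normal ` B))"
  proof -
    define w where "w v = c (inv_into B normal v) / sum c B" for v
    have w: "w (normal g) = c g / sum c B" if "g \<in> B" for g
      using inj that by (simp add: w_def)
    have "\<forall>v\<in>normal ` B. 0 < w v" using w c(1) pos by simp
    moreover have "sum w (normal ` B) = 1"
    proof -
      have "sum w (normal ` B) = (\<Sum>g\<in>B. c g / sum c B)" using w by (simp add: sum.reindex[OF inj])
      also have "\<dots> = 1" using pos by (simp add: sum_divide_distrib[symmetric])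
      finally show ?thesis .
    qed
    moreover have "(\<Sum>v\<in>normal ` B. w v *\<^sub>R v) = 0"
    proof -
      have "(\<Sum>v\<in>normal ` B. w v *\<^sub>R v) = (\<Sum>g\<in>B. (1 / sum c B) *\<^sub>R (c g *\<^sub>R normal g))"
        using w by (simp add: sum.reindex[OF inj])
      also have "\<dots> = (1 / sum c B) *\<^sub>R (\<Sum>g\<in>B. c g *\<^sub>R normal g)" by (simp only: scaleR_sum_right)
      finally show ?thesis using c(2) by simp
    qed
    ultimately show ?thesis unfolding rel_interior_convex_hull_explicit[OF aff] by blast
  qed
  moreover have "affine hull (normal ` B) = span (normal ` B)"
  proof (rule affine_hull_span_0)
    show "0 \<in> affine hull (normal ` B)"
      using ri rel_interior_subset convex_hull_subset_affine_hull by blast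
  qed
  ultimately show ?thesis using B(1) ne by (simp add: critical_simplex_def)
qed

lemma pins_core:
  assumes F: "\<forall>g\<in>F. constraint g" and fin: "finite F"
    and nd: "\<forall>g1\<in>F. \<forall>g2\<in>F. g1 \<noteq> g2 \<longrightarrow> \<not> degenerate_pair g1 g2"
    and u: "admissible F u 0" "u \<noteq> 0" and \<sigma>: "\<sigma> \<noteq> 0"
    and K0: "\<And>v. admissible F v 0 \<Longrightarrow> v \<noteq> 0 \<Longrightarrow> \<sigma> * pdet v > 0"
    and K: "\<And>v w. admissible F v w \<Longrightarrow> \<sigma> * w \<le> 0"
  obtains B c where "B \<subseteq> F" "pins B" "card B = 4" "inj_on height B"
    "\<forall>g\<in>B. normal g \<bullet> u = 0"
    "\<forall>g\<in>B. c g > (0::real)" "(\<Sum>g\<in>B. c g *\<^sub>R normal g) = 0"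
proof -
  define p where "p g = (normal g, - slope g)" for g
  have z: "(0::real^4, \<sigma>) \<bullet> y \<le> 0" if y: "\<And>g. g \<in> F \<Longrightarrow> p g \<bullet> y \<le> 0" for y
    using K[of "fst y" "snd y"] y by (simp add: p_def inner_prod_def admissible_def)
  obtain c0 where c0: "\<forall>g\<in>F. c0 g \<ge> 0" "(\<Sum>g\<in>F. c0 g *\<^sub>R p g) = (0, \<sigma>)"
    using farkas[of F p "(0, \<sigma>)", OF fin z] by blast
  have "\<exists>B c. B \<subseteq> F \<and> (\<forall>g\<in>B. c g > 0) \<and> (\<Sum>g\<in>B. c g *\<^sub>R p g) = (0, \<sigma>) \<and>
    (\<forall>a. (\<Sum>g\<in>B. a g *\<^sub>R p g) = 0 \<longrightarrow> (\<forall>g\<in>B. a g = 0))"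
    using c0 by (intro conic_caratheodory[OF fin, of c0]) auto
  then obtain B c where B: "B \<subseteq> F"
    and c': "\<forall>g\<in>B. c g > 0" and cz: "(\<Sum>g\<in>B. c g *\<^sub>R p g) = (0, \<sigma>)"
    and ind': "\<forall>a. (\<Sum>g\<in>B. a g *\<^sub>R p g) = 0 \<longrightarrow> (\<forall>g\<in>B. a g = 0)" by (elim exE conjE)
  have c: "c g > 0" if "g \<in> B" for g using c' that by (rule bspec)
  have ind: "a g = 0" if "(\<Sum>g\<in>B. a g *\<^sub>R p g) = 0" "g \<in> B" for a g
    using ind'[rule_format, OF that] .
  have finB: "finite B" using B fin by (rule finite_subset)
  have cn: "(\<Sum>g\<in>B. c g *\<^sub>R normal g) = 0"
    using arg_cong[OF cz, of fst] by (simp add: p_def fst_sum)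
  have cs: "(\<Sum>g\<in>B. c g * slope g) = - \<sigma>"
    using arg_cong[OF cz, of snd] by (simp add: p_def snd_sum sum_negf)
  have orth: "normal g \<bullet> v = 0" if "admissible B v 0" "g \<in> B" for v g
    using positive_relation_orthogonal[OF finB c cn] that by blast
  have FB: "\<forall>g\<in>B. constraint g" using F B by blast
  have pu: "pdet u \<noteq> 0" using K0[OF u] by auto
  have uB: "normal g \<bullet> u = 0" if "g \<in> B" for g
    using orth[OF admissible_mono[OF u(1) B] that] .
  have inj: "inj_on height B"
    by (rule inj_on_height[OF FB _ pu uB]) (use nd B in blast)
  \<comment> \<open>With fewer elements the normals alone are independent, so \<open>B\<close> is
    empty; but the slopes must combine to the nonzero value \<open>- \<sigma>\<close>.\<close>
  have ge: "card B \<ge> 4"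
  proof (rule ccontr)
    assume "\<not> card B \<ge> 4"
    then have "c g = 0" if "g \<in> B" for g
      using normal_relation_zero[OF FB finB _ inj pu uB cn that] by simp
    then have "B = {}" using c by force
    then show False using cs \<sigma> by simp
  qed
  moreover have "card B \<le> 4"
  proof -
    \<comment> \<open>The independent vectors \<open>p g\<close> lie in a hyperplane of the
      five-dimensional space R^4 x R.\<close>
    have "p ` B \<subseteq> {y. (u, 0) \<bullet> y = 0}"
      using uB by (auto simp: p_def inner_commute)
    then have "card B \<le> dim {y :: (real^4) \<times> real. (u, 0) \<bullet> y = 0}"
      by (intro card_le_dim_if_no_relation[of B p] finB ind)
    also have "\<dots> = 4" using u(2) by (subst dim_hyperplane) (auto simp: zero_prod_def)
    finally show ?thesis .
  qed
  moreover have "pins B"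
  proof (rule pins_if_admissible[OF FB])
    fix v assume v: "admissible B v 0" "v \<noteq> 0"
    have "card B \<ge> 3" using ge by simp
    \<comment> \<open>The slice of \<open>B\<close> lies on the line spanned by \<open>u\<close>,
      and the even form \<open>pdet\<close> has one sign on it.\<close>
    from common_orthogonal[OF FB finB this inj pu uB orth[OF v(1)]]
    obtain t where t: "v = t *\<^sub>R u" .
    then have "t \<noteq> 0" using v(2) by auto
    then show "\<sigma> * pdet v > 0"
      using K0[OF u] by (simp add: t pdet_scale mult.left_commute[of \<sigma>])
  next
    fix v w assume vw: "admissible B v w"
    \<comment> \<open>The positive combination of the inequalities of \<open>B\<close> is itself the
      bound on \<open>w\<close>.\<close>
    have "0 = (\<Sum>g\<in>B. c g *\<^sub>R normal g) \<bullet> v" using cn by simp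
    also have "\<dots> = (\<Sum>g\<in>B. c g * (normal g \<bullet> v))" by (simp add: inner_sum_left)
    also have "\<dots> \<le> (\<Sum>g\<in>B. c g * (slope g * w))"
      using vw c by (intro sum_mono mult_left_mono) (auto simp: admissible_def less_imp_le)
    also have "\<dots> = (\<Sum>g\<in>B. c g * slope g) * w" by (simp add: sum_distrib_right mult.assoc)
    finally show "\<sigma> * w \<le> 0" by (simp add: cs)
  qed
  ultimately show ?thesis by (intro that[OF B _ _ inj _ c' cn]) (auto simp: uB)
qed

theorem theorem27:
  fixes F :: "line set"
  assumes "\<forall>g\<in>F. constraint g"
    and "minimal_pinning F"
    and "\<forall>g1\<in>F. \<forall>g2\<in>F. g1 \<noteq> g2 \<longrightarrow> \<not> degenerate_pair g1 g2"
    and "\<not> pins (perp ` F)"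
  shows "finite F \<and> card F = 4 \<and> four_par_block (perp ` F)"
proof -
  note F = assms(1)
  have cnt: "countable F" using F assms(2) by (rule countable_if_minimal)
  have pin: "pins F" using assms(2) by (simp add: minimal_pinning_def)
  obtain u where u: "u \<noteq> 0" "admissible F u 0" using not_pins_perpD[OF F assms(4)] .
  obtain \<sigma> :: real where \<sigma>: "\<sigma> \<noteq> 0"
    and K0: "\<And>v. admissible F v 0 \<Longrightarrow> v \<noteq> 0 \<Longrightarrow> \<sigma> * pdet v > 0"
    and K: "\<And>v w. admissible F v w \<Longrightarrow> \<sigma> * w \<le> 0"
    by (rule pins_sign[OF F cnt pin u(2,1)]) (rule that; blast)
  have fin: "finite F" by (rule finite_if_minimal[OF F assms(2) K0 K])
  obtain B c where B: "B \<subseteq> F" "pins B" and core: "card B = 4" "inj_on height B"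
    "\<forall>g\<in>B. normal g \<bullet> u = 0"
    "\<forall>g\<in>B. c g > (0::real)" "(\<Sum>g\<in>B. c g *\<^sub>R normal g) = 0"
    by (rule pins_core[OF F fin assms(3) u(2,1) \<sigma> K0 K])
  have "B = F" using B assms(2) by (auto simp: minimal_pinning_def)
  note core = core(1,2) bspec[OF core(3)] bspec[OF core(4)] core(5)
  note core = core[unfolded \<open>B = F\<close>]
  have pu: "pdet u \<noteq> 0" using K0[OF u(2,1)] by auto
  have crit: "critical_simplex (normal ` F)"
    by (rule critical_simplex_normal[OF F fin core(1,2) pu core(3-5)])
  have inj: "inj_on normal F" by (rule inj_on_normal[OF F core(2) pu core(3)])
  \<comment> \<open>\<open>perp\<close> preserves normals, and these are distinct on
    \<open>F\<close>.\<close>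
  have "inj_on perp F"
  proof (rule inj_onI)
    fix g h assume "g \<in> F" "h \<in> F" "perp g = perp h"
    then show "g = h" using inj_onD[OF inj, of g h] normal_perp[of g] normal_perp[of h] by simp
  qed
  then have "card (perp ` F) = 4" using core(1) by (simp add: card_image)
  moreover have "inj_on normal (perp ` F)"
  proof (rule inj_onI)
    fix x y assume "x \<in> perp ` F" "y \<in> perp ` F" "normal x = normal y"
    then obtain g h where "x = perp g" "y = perp h" "g \<in> F" "h \<in> F" by blast
    with \<open>normal x = normal y\<close> show "x = y" using inj_onD[OF inj, of g h] by simp
  qed
  moreover have "normal ` perp ` F = normal ` F" by (simp add: image_image)
  moreover have "\<forall>g\<in>perp ` F. orthogonal_constraint g" using F orthogonal_constraint_perp by auto
  moreover have "hyperboloidal (perp ` F)" by (rule hyperboloidal_perp[OF F pu core(3)])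
  ultimately show ?thesis using fin crit core(1) by (simp add: four_par_block_def block_def)
qed

end
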